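(* Let $\Gamma$ be a finite group of order $k\ge 2$. Let $D$ be an Eulerian digraph with an edge-labelling $w:E(D)\to\Gamma$ and with minimum and maximum common degrees $\delta$ and $\Delta>0$, respectively. If $$\frac{\delta^3}{\Delta^2}\ge 32e^3k,$$ then $D$ contains at least $$\frac{\delta^4}{128e^3k\Delta^2}$$ pairwise edge-disjoint zero-sum directed cycles, where $e$ is the base of the natural logarithm.
   Context: All digraphs are finite, nonempty, simple and loopless: for each ordered pair $(u,v)$ there is at most one edge from $u$ to $v$, there are no edges from a vertex to itself, and both opposite edges $uv$ and $vu$ may be present. A digraph is Eulerian if the outdegree $d^+(v)$ equals the indegree $d^-(v)$ for every vertex $v$ (connectivity is not required); the common degree is $d(v):=d^+(v)=d^-(v)$, and $\delta:=\min_v d(v)$, $\Delta:=\max_v d(v)$. A directed cycle $C=v_1v_2\cdots v_\ell v_1$ has distinct vertices $v_1,\dots,v_\ell$ and all displayed edges in $D$ (so $\ell\ge 2$); cycles differing by cyclic rotation are the same. $\Gamma$ is written multiplicatively with identity $1_\Gamma$ and need not be abelian. The ordered label product of $C$ is $w(C)=w(v_1v_2)w(v_2v_3)\cdots w(v_\ell v_1)$; $C$ is zero-sum if $w(C)=1_\Gamma$ (independent of the choice of initial vertex). *)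

theory Defs
  imports Complex_Main "Graph_Theory.Digraph" "Graph_Theory.Arc_Walk" "HOL-Algebra.Coset"
begin

definition eulerian_digraph :: "('a, 'b) pre_digraph \<Rightarrow> bool" where
  "eulerian_digraph D \<longleftrightarrow> digraph D \<and> verts D \<noteq> {} \<and>
     (\<forall>v \<in> verts D. out_degree D v = in_degree D v)"

text \<open>Only meaningful for Eulerian digraphs, where out-degree and in-degree agree.\<close>

definition common_degree :: "('a, 'b) pre_digraph \<Rightarrow> 'a \<Rightarrow> nat" where
  "common_degree D v = out_degree D v"

definition min_degree :: "('a, 'b) pre_digraph \<Rightarrow> nat" where
  "min_degree D = Min (common_degree D ` verts D)"

definition max_degree :: "('a, 'b) pre_digraph \<Rightarrow> nat" where
  "max_degree D = Max (common_degree D ` verts D)"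

definition label_prod :: "('g, 'm) monoid_scheme \<Rightarrow> ('b \<Rightarrow> 'g) \<Rightarrow> 'b list \<Rightarrow> 'g" where
  "label_prod \<Gamma> w p = foldr (\<otimes>\<^bsub>\<Gamma>\<^esub>) (map w p) \<one>\<^bsub>\<Gamma>\<^esub>"

text \<open>
  A directed cycle is given by the list of its arcs, read from some initial vertex;
  lists differing by rotation represent the same cycle.
\<close>

definition zero_sum_cycle ::
  "('a, 'b) pre_digraph \<Rightarrow> ('g, 'm) monoid_scheme \<Rightarrow> ('b \<Rightarrow> 'g) \<Rightarrow> 'b list \<Rightarrow> bool" where
  "zero_sum_cycle D \<Gamma> w p \<longleftrightarrow> pre_digraph.cycle D p \<and> label_prod \<Gamma> w p = \<one>\<^bsub>\<Gamma>\<^esub>"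

text \<open>
  Rotations of a cycle share all their (at least one) arcs, so a family of pairwise
  edge-disjoint arc lists contains at most one representative of each cycle.
\<close>

definition edge_disjoint_family :: "'b list set \<Rightarrow> bool" where
  "edge_disjoint_family \<C> \<longleftrightarrow> pairwise (\<lambda>p q. set p \<inter> set q = {}) \<C>"

context group
begin

lemma label_prod_closed:
  "w \<in> set p \<rightarrow> carrier G \<Longrightarrow> label_prod G w p \<in> carrier G"
  by (induction p) (auto simp: label_prod_def)

lemma label_prod_append:
  "w \<in> set p \<union> set q \<rightarrow> carrier G \<Longrightarrow>
   label_prod G w (p @ q) = label_prod G w p \<otimes> label_prod G w q"
proof (induction p)
  case Nil
  then show ?case using label_prod_closed[of w q] by (simp add: label_prod_def)
next
  case (Cons a p)
  have "w a \<in> carrier G" "w \<in> set p \<rightarrow> carrier G" "w \<in> set q \<rightarrow> carrier G"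
    using Cons.prems by auto
  moreover have "label_prod G w (x # xs) = w x \<otimes> label_prod G w xs" for x xs
    by (simp add: label_prod_def)
  moreover have "label_prod G w (p @ q) = label_prod G w p \<otimes> label_prod G w q"
    using Cons by auto
  ultimately show ?case using label_prod_closed[of w p] label_prod_closed[of w q]
    by (simp add: m_assoc)
qed

text \<open>Being zero-sum does not depend on the choice of the initial vertex.\<close>

lemma label_prod_append_eq_one_commute:
  assumes "w \<in> set p \<union> set q \<rightarrow> carrier G"
  shows "label_prod G w (p @ q) = \<one> \<longleftrightarrow> label_prod G w (q @ p) = \<one>"
proof -
  have "label_prod G w p \<in> carrier G" "label_prod G w q \<in> carrier G"
    using assms by (auto intro!: label_prod_closed)
  moreover have "label_prod G w (p @ q) = label_prod G w p \<otimes> label_prod G w q"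
    "label_prod G w (q @ p) = label_prod G w q \<otimes> label_prod G w p"
    using assms by (auto intro!: label_prod_append)
  ultimately show ?thesis using inv_comm by metis
qed

end

end

theory Submission
  imports Defs "HOL-Library.FuncSet" "Graph_Theory.Digraph_Component"
begin

text \<open>
  Give every vertex \<open>v\<close> a pair \<open>(x\<^sub>v, c\<^sub>v)\<close> of a group element and one of \<open>r\<close> colours, and
  call an arc \<open>a\<close> from \<open>u\<close> to \<open>v\<close> good if \<open>c\<^sub>u = c\<^sub>v\<close> and \<open>x\<^sub>u w(a) = x\<^sub>v\<close>. Label products
  telescope, so every cycle of good arcs is zero-sum, and cycles of different colours are
  vertex-disjoint. If every vertex has a good out-arc and no colour is empty, there are thus
  \<open>r\<close> vertex-disjoint zero-sum cycles. Deleting them lowers each out-degree by at most one, so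
  this can be repeated about \<open>\<delta>/2\<close> times.

  A uniformly random choice of the pairs and the local lemma would need
  \<open>\<delta> \<ge> C k r log \<Delta>\<close>. To avoid the logarithm, the list of \<open>k r\<close> candidates of every vertex is thinned in
  stages, from size \<open>s\<close> to about \<open>\<surd>s\<close>: by the local lemma and Chernoff bounds, the degrees between
  surviving candidates can be kept proportional to the list size up to factors whose product
  converges. Once the lists have bounded size, a single application of the local lemma finishes.
\<close>

subsection \<open>The symmetric local lemma on finite product spaces\<close>

text \<open>Independence in counting form. Exchanging the coordinates in \<open>D\<close> between
  two points is an involution of pairs, and it carries
  \<open>(X \<inter> Y) \<times> PiE I F\<close> onto \<open>X \<times> Y\<close>.\<close>

lemma card_Int_independent:
  fixes F :: "'i \<Rightarrow> 'c set"
  assumes fin: "finite I" "\<And>i. i \<in> I \<Longrightarrow> finite (F i)"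
    and X: "X \<subseteq> PiE I F" "\<And>f g. \<lbrakk>f \<in> X; g \<in> PiE I F; \<And>i. i \<in> D \<Longrightarrow> f i = g i\<rbrakk> \<Longrightarrow> g \<in> X"
    and Y: "Y \<subseteq> PiE I F" "\<And>f g. \<lbrakk>f \<in> Y; g \<in> PiE I F; \<And>i. i \<in> I - D \<Longrightarrow> f i = g i\<rbrakk> \<Longrightarrow> g \<in> Y"
  shows "card (X \<inter> Y) * card (PiE I F) = card X * card Y"
proof -
  define mix where "mix = (\<lambda>(f :: 'i \<Rightarrow> 'c) g i. if i \<in> D then f i else g i)"
  define swap where "swap = (\<lambda>(f, g). (mix f g, mix g f))"
  have mix_in: "mix f g \<in> PiE I F" if "f \<in> PiE I F" "g \<in> PiE I F" for f g
    using that by (auto simp: mix_def PiE_iff extensional_def)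
  have mixD: "i \<in> D \<Longrightarrow> mix f g i = f i" "i \<notin> D \<Longrightarrow> mix f g i = g i" for f g i
    by (auto simp: mix_def)
  have invol: "swap (swap p) = p" for p
    by (auto simp: swap_def mix_def split: prod.splits)
  have "bij_betw swap ((X \<inter> Y) \<times> PiE I F) (X \<times> Y)"
  proof (rule bij_betw_byWitness[where f' = swap])
    show "swap ` ((X \<inter> Y) \<times> PiE I F) \<subseteq> X \<times> Y"
    proof (clarsimp simp: swap_def)
      fix f g assume f: "f \<in> X" "f \<in> Y" and g: "g \<in> PiE I F"
      have f': "f \<in> PiE I F" using f X(1) by blast
      have "mix f g \<in> X" using f(1) by (rule X(2)) (simp_all add: f' g mix_in mixD)
      moreover have "mix g f \<in> Y" using f(2) by (rule Y(2)) (simp_all add: f' g mix_in mixD)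
      ultimately show "mix f g \<in> X \<and> mix g f \<in> Y" ..
    qed
    show "swap ` (X \<times> Y) \<subseteq> (X \<inter> Y) \<times> PiE I F"
    proof (clarsimp simp: swap_def)
      fix f g assume f: "f \<in> X" and g: "g \<in> Y"
      have f': "f \<in> PiE I F" and g': "g \<in> PiE I F" using f g X(1) Y(1) by blast+
      have "mix f g \<in> X" using f by (rule X(2)) (simp_all add: f' g' mix_in mixD)
      moreover have "mix f g \<in> Y" using g by (rule Y(2)) (simp_all add: f' g' mix_in mixD)
      ultimately show "mix f g \<in> X \<and> mix f g \<in> Y \<and> mix g f \<in> PiE I F"
        using mix_in[OF g' f'] by blast
    qed
  qed (use invol in auto)
  then show ?thesis
    using bij_betw_same_card by (fastforce simp: card_cartesian_product)
qed

text \<open>Probabilities are ratios of counts in the uniform product space, and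
  \<open>supp e\<close> holds the coordinates that decide \<open>A e\<close>. An event with nonempty
  support counts among its own neighbours; empty supports allow \<open>d = 0\<close>, hence the
  separate bound \<open>4 * p \<le> 1\<close>.\<close>

lemma lovasz_local_lemma:
  fixes F :: "'i \<Rightarrow> 'c set" and A :: "'e \<Rightarrow> ('i \<Rightarrow> 'c) set" and p d :: real
  assumes fin: "finite I" "\<And>i. i \<in> I \<Longrightarrow> finite (F i)" and ne: "\<And>i. i \<in> I \<Longrightarrow> F i \<noteq> {}"
    and J: "finite J"
    and A: "\<And>e. e \<in> J \<Longrightarrow> A e \<subseteq> PiE I F"
    and det: "\<And>e f g. \<lbrakk>e \<in> J; f \<in> A e; g \<in> PiE I F; \<And>i. i \<in> supp e \<Longrightarrow> f i = g i\<rbrakk> \<Longrightarrow> g \<in> A e"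
    and p: "\<And>e. e \<in> J \<Longrightarrow> real (card (A e)) \<le> p * card (PiE I F)" "p \<ge> 0"
    and d: "\<And>e. e \<in> J \<Longrightarrow> real (card {e' \<in> J. supp e \<inter> supp e' \<noteq> {}}) \<le> d"
    and pd: "4 * p * d \<le> 1" "4 * p \<le> 1"
  shows "\<exists>f \<in> PiE I F. \<forall>e \<in> J. f \<notin> A e"
proof -
  let ?\<Omega> = "PiE I F"
  define G where "G S = {f \<in> ?\<Omega>. \<forall>e \<in> S. f \<notin> A e}" for S
  have fin\<Omega>: "finite ?\<Omega>" using fin by (simp add: finite_PiE)
  have finG: "finite (G S)" for S using fin\<Omega> by (simp add: G_def)
  have card\<Omega>: "card ?\<Omega> > 0" using fin\<Omega> ne by (simp add: card_gt_0_iff PiE_eq_empty_iff)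
  \<comment> \<open>\<open>G S\<close> is the event that nothing in \<open>S\<close> happens.
    Conditioned on it, each event has probability at most 2p, twice its unconditional bound.
    Induction on the size of \<open>S\<close>.\<close>
  have cond: "real (card (A e \<inter> G S)) \<le> 2 * p * card (G S)" if "S \<subseteq> J" "e \<in> J" for S e
    using that
  proof (induction "card S" arbitrary: S e rule: less_induct)
    case less
    have finS: "finite S" using less.prems J finite_subset by blast
    define S1 where "S1 = {e' \<in> S. supp e \<inter> supp e' \<noteq> {}}"
    define S2 where "S2 = S - S1"
    have S2: "S2 \<subseteq> J" "S = S1 \<union> S2" "finite S1" using less.prems finS by (auto simp: S1_def S2_def)
    have "card (A e \<inter> G S2) * card ?\<Omega> = card (A e) * card (G S2)"
    proof (rule card_Int_independent[OF fin, where D = "supp e"])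
      fix f g assume f: "f \<in> G S2" and g: "g \<in> ?\<Omega>" and eq: "\<And>i. i \<in> I - supp e \<Longrightarrow> f i = g i"
      have "g \<notin> A e'" if e': "e' \<in> S2" for e'
      proof
        assume "g \<in> A e'"
        moreover have "g i = f i" if "i \<in> supp e'" for i
        proof (cases "i \<in> I")
          case True
          with that e' show ?thesis using eq[of i] by (fastforce simp: S2_def S1_def)
        next
          case False
          moreover have "f \<in> ?\<Omega>" using f unfolding G_def by blast
          ultimately show ?thesis using g PiE_arb[of f I F i] PiE_arb[of g I F i] by metis
        qed
        ultimately have "f \<in> A e'" using det[of e' g f] e' S2(1) f unfolding G_def by blast
        with f e' show False by (auto simp: G_def)
      qed
      with g show "g \<in> G S2" by (auto simp: G_def)
    next
      fix f g assume "f \<in> A e" "g \<in> ?\<Omega>" "\<And>i. i \<in> supp e \<Longrightarrow> f i = g i"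
      then show "g \<in> A e" using \<open>e \<in> J\<close> det by blast
    next
      show "A e \<subseteq> ?\<Omega>" using \<open>e \<in> J\<close> by (rule A)
    next
      show "G S2 \<subseteq> ?\<Omega>" unfolding G_def by blast
    qed
    then have "real (card (A e \<inter> G S2)) * card ?\<Omega> = card (A e) * card (G S2)"
      by (metis of_nat_mult)
    also have "\<dots> \<le> p * card ?\<Omega> * card (G S2)"
      unfolding of_nat_mult using p(1)[OF \<open>e \<in> J\<close>] by (intro mult_right_mono) auto
    finally have indep: "real (card (A e \<inter> G S2)) \<le> p * card (G S2)"
      using card\<Omega> by (simp add: mult.commute mult.left_commute)
    \<comment> \<open>Inside \<open>G S2\<close>, each event of \<open>S1\<close> has share at most
      2p by induction. There are at most d of them, so avoiding them all costs at most 2pd \<le>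
      1/2. The denominator thus shrinks by at most a factor 2, which turns p into 2p.\<close>
    have half: "real (card (G S2)) \<le> 2 * card (G S)"
    proof (cases "S1 = {}")
      case True then show ?thesis using S2 by simp
    next
      case False
      then have less2: "card S2 < card S" using finS
        by (intro psubset_card_mono) (auto simp: S1_def S2_def)
      have "card S1 \<le> card {e' \<in> J. supp e \<inter> supp e' \<noteq> {}}"
        using less.prems J by (intro card_mono) (auto simp: S1_def)
      then have S1d: "real (card S1) \<le> d" using d[OF \<open>e \<in> J\<close>] by simp
      have "G S2 \<subseteq> G S \<union> (\<Union>e'\<in>S1. A e' \<inter> G S2)" by (auto simp: G_def S2_def)
      then have "card (G S2) \<le> card (G S \<union> (\<Union>e'\<in>S1. A e' \<inter> G S2))"
        using finG S2 by (intro card_mono) auto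
      also have "\<dots> \<le> card (G S) + card (\<Union>e'\<in>S1. A e' \<inter> G S2)" by (rule card_Un_le)
      also have "card (\<Union>e'\<in>S1. A e' \<inter> G S2) \<le> (\<Sum>e'\<in>S1. card (A e' \<inter> G S2))"
        using S2 by (intro card_UN_le)
      finally have "real (card (G S2)) \<le> card (G S) + (\<Sum>e'\<in>S1. real (card (A e' \<inter> G S2)))"
        by (simp flip: of_nat_sum of_nat_add)
      also have "(\<Sum>e'\<in>S1. real (card (A e' \<inter> G S2))) \<le> (\<Sum>e'\<in>S1. 2 * p * card (G S2))"
        using less.hyps[OF less2 S2(1)] less.prems by (intro sum_mono) (auto simp: S1_def)
      also have "\<dots> = (2 * p * card S1) * card (G S2)" by simp
      also have "\<dots> \<le> 1/2 * card (G S2)"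
      proof (rule mult_right_mono)
        have "p * card S1 \<le> p * d" using S1d p(2) by (intro mult_left_mono) auto
        then show "2 * p * card S1 \<le> 1/2" using pd by simp
      qed simp
      finally show ?thesis by simp
    qed
    have "real (card (A e \<inter> G S)) \<le> card (A e \<inter> G S2)"
      using finG by (intro of_nat_mono card_mono) (auto simp: G_def S2_def)
    also note indep
    also have "p * card (G S2) \<le> p * (2 * card (G S))" using half p(2) by (intro mult_left_mono)
    finally show ?case by simp
  qed
  \<comment> \<open>Events are avoided one at a time; each removes at most half of what is
    left.\<close>
  have "card (G S) > 0" if "finite S" "S \<subseteq> J" for S
    using that
  proof (induction S rule: finite_induct)
    case empty
    then show ?case using card\<Omega> by (simp add: G_def)
  next
    case (insert e S)
    have "card (G S) \<le> card (G (insert e S) \<union> (A e \<inter> G S))"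
    proof (rule card_mono)
      show "finite (G (insert e S) \<union> (A e \<inter> G S))" using finG by blast
      show "G S \<subseteq> G (insert e S) \<union> (A e \<inter> G S)" unfolding G_def by blast
    qed
    also have "\<dots> \<le> card (G (insert e S)) + card (A e \<inter> G S)" by (rule card_Un_le)
    finally have "real (card (G S)) \<le> card (G (insert e S)) + card (A e \<inter> G S)" by linarith
    moreover have "real (card (A e \<inter> G S)) \<le> 2 * p * card (G S)" using insert by (intro cond) auto
    moreover have "2 * p * card (G S) \<le> 1/2 * card (G S)" using pd by (intro mult_right_mono) auto
    moreover have "card (G S) > 0" using insert by auto
    ultimately show ?case by linarith
  qed
  from this[OF J] have "G J \<noteq> {}" by force
  then show ?thesis by (auto simp: G_def)
qed

subsection \<open>Random thinning\<close>

text \<open>Under the uniform measure on this product, the sublists at different vertices are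
  independent uniform t-subsets.\<close>

definition thinnings :: "'v set \<Rightarrow> ('v \<Rightarrow> 'p set) \<Rightarrow> nat \<Rightarrow> ('v \<Rightarrow> 'p set) set" where
  "thinnings V L t = PiE V (\<lambda>v. {T. T \<subseteq> L v \<and> card T = t})"

definition kept :: "('p \<Rightarrow> 'v) \<Rightarrow> 'p set \<Rightarrow> ('v \<Rightarrow> 'p set) \<Rightarrow> 'p set" where
  "kept \<pi> W f = {p \<in> W. p \<in> f (\<pi> p)}"

text \<open>A random t-subset of \<open>L\<close> contains \<open>p\<close> with probability t/|L|;
  this is the resulting expectation without normalisation. For t > |L| both sides vanish.\<close>

lemma sum_subsets_weight:
  fixes c :: real
  assumes "finite L" "p \<in> L"
  shows "(\<Sum>T | T \<subseteq> L \<and> card T = t. if p \<in> T then c else 1) =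
    real (card L choose t) * (1 + real t / card L * (c - 1))"
proof (cases "t \<le> card L")
  case False
  have none: "{T. T \<subseteq> L \<and> card T = t} = {}" using False assms card_mono by fastforce
  show ?thesis unfolding none using False by (simp add: binomial_eq_0)
next
  case True
  define B where "B = {T. T \<subseteq> L \<and> card T = t}"
  have finB: "finite B" using assms by (simp add: B_def)
  have cardL: "card L > 0" using assms card_gt_0_iff by blast
  have B: "B \<inter> {T. p \<notin> T} = {T. T \<subseteq> L - {p} \<and> card T = t}" by (auto simp: B_def)
  have "card (B \<inter> {T. p \<notin> T}) = (card L - 1) choose t"
    unfolding B using assms by (subst n_subsets) auto
  then have notin: "real (card L) * card (B \<inter> {T. p \<notin> T}) = (real (card L) - t) * (card L choose t)"
    using binomial_absorb_comp[of "card L" t] True by (metis of_nat_mult of_nat_diff)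
  have "card B = card (B \<inter> {T. p \<in> T}) + card (B \<inter> {T. p \<notin> T})"
    using finB by (subst card_Un_disjoint[symmetric]) (auto intro: arg_cong[where f = card])
  moreover have "card B = card L choose t" unfolding B_def using assms by (simp add: n_subsets)
  ultimately have isin: "real (card (B \<inter> {T. p \<in> T})) = real (card L choose t) - card (B \<inter> {T. p \<notin> T})"
    by linarith
  have "(\<Sum>T\<in>B. if p \<in> T then c else 1) = c * card (B \<inter> {T. p \<in> T}) + card (B \<inter> {T. p \<notin> T})"
    using finB by (simp add: sum.If_cases Collect_neg_eq[symmetric])
  also have "\<dots> = c * (card L choose t) - (c - 1) * card (B \<inter> {T. p \<notin> T})"
    unfolding isin by (simp add: algebra_simps)
  also have "real (card (B \<inter> {T. p \<notin> T})) = (real (card L) - t) * (card L choose t) / card L"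
    using notin cardL by (simp add: field_simps)
  also have "c * (card L choose t) - (c - 1) * \<dots> = (card L choose t) * (1 + real t / card L * (c - 1))"
    using cardL by (simp add: field_simps)
  finally show ?thesis by (simp add: B_def)
qed

section \<open>Tail bounds for the number of survivors\<close>

locale thinning =
  fixes V :: "'v set" and L :: "'v \<Rightarrow> 'p set" and \<pi> :: "'p \<Rightarrow> 'v" and s t :: nat
  assumes finV: "finite V"
    and finL: "\<And>v. v \<in> V \<Longrightarrow> finite (L v)"
    and cardL: "\<And>v. v \<in> V \<Longrightarrow> card (L v) = s"
    and t: "1 \<le> t" "t \<le> s"
begin

abbreviation "\<Omega> \<equiv> thinnings V L t"

lemma finite_thinnings: "finite \<Omega>"
  unfolding thinnings_def using finV finL by (intro finite_PiE) auto

lemma card_thinnings: "card \<Omega> = (s choose t) ^ card V"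
  unfolding thinnings_def using finV finL cardL by (simp add: card_PiE n_subsets)

text \<open>Generating function of the number of survivors in \<open>W\<close>. As
  \<open>\<pi>\<close> is injective on \<open>W\<close>, distinct elements are decided at distinct
  vertices, so the sum over the product space factorises as for a binomial variable.\<close>

lemma sum_power_card_kept:
  fixes c :: real
  assumes W: "finite W" "inj_on \<pi> W" "\<And>p. p \<in> W \<Longrightarrow> \<pi> p \<in> V \<and> p \<in> L (\<pi> p)"
  shows "(\<Sum>f\<in>\<Omega>. c ^ card (kept \<pi> W f)) = card \<Omega> * (1 + real t / s * (c - 1)) ^ card W"
proof -
  define g where "g = inv_into W \<pi>"
  define h where "h = (\<lambda>v T. if v \<in> \<pi> ` W \<and> g v \<in> T then c else 1)"
  let ?q = "1 + real t / s * (c - 1)"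
  have g: "g (\<pi> p) = p" if "p \<in> W" for p using W(2) that by (simp add: g_def)
  have sub: "\<pi> ` W \<subseteq> V" using W by auto
  have "c ^ card (kept \<pi> W f) = (\<Prod>v\<in>V. h v (f v))" for f
  proof -
    have "(\<Prod>v\<in>V. h v (f v)) = (\<Prod>v\<in>\<pi> ` W. h v (f v))"
      using finV sub by (intro prod.mono_neutral_right) (auto simp: h_def)
    also have "\<dots> = (\<Prod>p\<in>W. if p \<in> f (\<pi> p) then c else 1)"
      using W(2) g by (subst prod.reindex) (auto simp: h_def intro!: prod.cong)
    also have "\<dots> = (\<Prod>p\<in>kept \<pi> W f. c)"
      unfolding kept_def using W(1) by (intro prod.inter_filter[symmetric])
    finally show ?thesis by simp
  qed
  then have "(\<Sum>f\<in>\<Omega>. c ^ card (kept \<pi> W f)) = (\<Sum>f\<in>\<Omega>. \<Prod>v\<in>V. h v (f v))" by simp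
  also have "\<dots> = (\<Prod>v\<in>V. \<Sum>T | T \<subseteq> L v \<and> card T = t. h v T)"
    unfolding thinnings_def using finV finL by (intro prod_sum_PiE[symmetric]) auto
  also have "\<dots> = (\<Prod>v\<in>V. (s choose t) * (if v \<in> \<pi> ` W then ?q else 1))"
  proof (intro prod.cong refl)
    fix v assume v: "v \<in> V"
    show "(\<Sum>T | T \<subseteq> L v \<and> card T = t. h v T) = (s choose t) * (if v \<in> \<pi> ` W then ?q else 1)"
    proof (cases "v \<in> \<pi> ` W")
      case True
      then have "g v \<in> L v" using W(3) g by auto
      then show ?thesis using True sum_subsets_weight[of "L v" "g v" c t] v finL cardL
        by (simp add: h_def)
    next
      case False
      then show ?thesis using v finL cardL by (simp add: h_def n_subsets)
    qed
  qed
  also have "\<dots> = real (s choose t) ^ card V * (\<Prod>v\<in>V. if v \<in> \<pi> ` W then ?q else 1)"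
    by (simp add: prod.distrib)
  also have "(\<Prod>v\<in>V. if v \<in> \<pi> ` W then ?q else 1) = (\<Prod>v\<in>\<pi> ` W. ?q)"
    using finV sub by (simp add: prod.If_cases Int_absorb1)
  also have "\<dots> = ?q ^ card W" using W by (simp add: card_image)
  finally show ?thesis by (simp add: card_thinnings)
qed

text \<open>The generating function at c = 0, where 0^0 = 1 makes it count the choices in which
  nothing of \<open>W\<close> survives.\<close>

lemma card_kept_eq_0_tail:
  fixes m :: real
  assumes W: "finite W" "inj_on \<pi> W" "\<And>p. p \<in> W \<Longrightarrow> \<pi> p \<in> V \<and> p \<in> L (\<pi> p)"
    and m: "m \<le> real (card W)"
  shows "real (card {f \<in> \<Omega>. card (kept \<pi> W f) = 0}) \<le> exp (- (t * m / s)) * card \<Omega>"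
proof -
  have s: "s > 0" using t by simp
  have "real (card {f \<in> \<Omega>. card (kept \<pi> W f) = 0}) = (\<Sum>f\<in>\<Omega>. 0 ^ card (kept \<pi> W f))"
    using finite_thinnings by (simp add: power_0_left sum.If_cases Int_def)
  also have "\<dots> = card \<Omega> * (1 - real t / s) ^ card W"
    using sum_power_card_kept[OF W, of 0] by simp
  also have "\<dots> \<le> card \<Omega> * exp (- (t * m / s))"
  proof (rule mult_left_mono)
    have "(1 - real t / s) ^ card W \<le> exp (- (real t / s)) ^ card W"
      using exp_ge_add_one_self[of "- (real t / s)"] t s by (intro power_mono) auto
    also have "\<dots> = exp (- (real t / s * card W))" by (simp add: exp_of_nat_mult[symmetric] mult.commute)
    also have "\<dots> \<le> exp (- (t * m / s))"
      using mult_left_mono[OF m, of "real t / s"] by simp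
    finally show "(1 - real t / s) ^ card W \<le> exp (- (t * m / s))" .
  qed simp
  finally show ?thesis by (simp add: mult.commute)
qed

text \<open>The generating function at c = e^\<theta>, with 1 + x \<le> e^x. Negative \<theta> is
  covered too and serves the lower tail.\<close>

lemma sum_exp_card_kept_le:
  fixes \<theta> :: real
  assumes W: "finite W" "inj_on \<pi> W" "\<And>p. p \<in> W \<Longrightarrow> \<pi> p \<in> V \<and> p \<in> L (\<pi> p)"
  shows "(\<Sum>f\<in>\<Omega>. exp (\<theta> * card (kept \<pi> W f))) \<le> exp (real t / s * (exp \<theta> - 1) * card W) * card \<Omega>"
proof -
  have s: "s > 0" using t by simp
  have "(\<Sum>f\<in>\<Omega>. exp (\<theta> * card (kept \<pi> W f))) = (\<Sum>f\<in>\<Omega>. exp \<theta> ^ card (kept \<pi> W f))"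
    by (simp add: exp_of_nat_mult[symmetric] mult.commute)
  also have "\<dots> = card \<Omega> * (1 + real t / s * (exp \<theta> - 1)) ^ card W"
    using sum_power_card_kept[OF W] by simp
  also have "\<dots> \<le> card \<Omega> * exp (real t / s * (exp \<theta> - 1) * card W)"
  proof (rule mult_left_mono)
    have "(1 + real t / s * (exp \<theta> - 1)) ^ card W \<le> exp (real t / s * (exp \<theta> - 1)) ^ card W"
    proof (intro power_mono)
      have "real t / s * (exp \<theta> - 1) \<ge> real t / s * (-1)" by (intro mult_left_mono) auto
      moreover have "real t / s \<le> 1" using t s by simp
      ultimately show "0 \<le> 1 + real t / s * (exp \<theta> - 1)" by linarith
    qed (simp add: exp_ge_add_one_self)
    also have "\<dots> = exp (real t / s * (exp \<theta> - 1) * card W)"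
      by (simp add: exp_of_nat_mult[symmetric] mult.commute)
    finally show "(1 + real t / s * (exp \<theta> - 1)) ^ card W \<le> exp (real t / s * (exp \<theta> - 1) * card W)" .
  qed simp
  finally show ?thesis by (simp add: mult.commute)
qed

lemma exp_markov:
  fixes a \<theta> :: real
  shows
  "real (card {f \<in> \<Omega>. \<theta> * card (kept \<pi> W f) \<ge> a}) * exp a \<le> (\<Sum>f\<in>\<Omega>. exp (\<theta> * card (kept \<pi> W f)))"
proof -
  have "real (card {f \<in> \<Omega>. \<theta> * card (kept \<pi> W f) \<ge> a}) * exp a =
      (\<Sum>f | f \<in> \<Omega> \<and> \<theta> * card (kept \<pi> W f) \<ge> a. exp a)" by simp
  also have "\<dots> \<le> (\<Sum>f | f \<in> \<Omega> \<and> \<theta> * card (kept \<pi> W f) \<ge> a. exp (\<theta> * card (kept \<pi> W f)))"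
    by (intro sum_mono) auto
  also have "\<dots> \<le> (\<Sum>f\<in>\<Omega>. exp (\<theta> * card (kept \<pi> W f)))"
    using finite_thinnings by (intro sum_mono2) auto
  finally show ?thesis .
qed

text \<open>Markov's inequality for e^(\<theta>X) with \<theta> = \<epsilon>/2 and e^\<theta> - 1
  \<le> \<theta> + \<theta>^2. Here \<mu> = tM/s only bounds the mean from above, and the exponent
  is at most \<theta>^2 \<mu> - \<theta>\<epsilon>\<mu> = -\<epsilon>^2 \<mu>/4.\<close>

lemma chernoff_upper:
  fixes M \<epsilon> :: real
  assumes W: "finite W" "inj_on \<pi> W" "\<And>p. p \<in> W \<Longrightarrow> \<pi> p \<in> V \<and> p \<in> L (\<pi> p)"
    and M: "real (card W) \<le> M" and \<epsilon>: "0 < \<epsilon>" "\<epsilon> \<le> 1"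
  shows "real (card {f \<in> \<Omega>. card (kept \<pi> W f) > (1 + \<epsilon>) * (t * M / s)}) \<le>
    exp (- (\<epsilon>\<^sup>2 * (t * M / s) / 4)) * card \<Omega>"
proof -
  define \<mu> where "\<mu> = t * M / s"
  define \<theta> where "\<theta> = \<epsilon> / 2"
  have \<mu>: "\<mu> \<ge> 0" using M by (simp add: \<mu>_def)
  have "exp \<theta> - 1 \<le> \<theta> + \<theta>\<^sup>2" using exp_bound[of \<theta>] \<epsilon> by (simp add: \<theta>_def)
  moreover have "real t / s * card W \<le> \<mu>"
    using mult_left_mono[OF M, of "real t / s"] by (simp add: \<mu>_def)
  ultimately have le: "(exp \<theta> - 1) * (real t / s * card W) \<le> (\<theta> + \<theta>\<^sup>2) * \<mu>"
    using \<epsilon> by (intro mult_mono) (auto simp: \<theta>_def)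
  have expo: "real t / s * (exp \<theta> - 1) * card W - \<theta> * ((1 + \<epsilon>) * \<mu>) \<le> - (\<epsilon>\<^sup>2 * \<mu> / 4)"
  proof -
    have "real t / s * (exp \<theta> - 1) * card W = (exp \<theta> - 1) * (real t / s * card W)"
      by (simp add: algebra_simps)
    also have "\<dots> \<le> (\<theta> + \<theta>\<^sup>2) * \<mu>" using le by simp
    finally show ?thesis by (simp add: \<theta>_def field_simps power2_eq_square)
  qed
  have "real (card {f \<in> \<Omega>. card (kept \<pi> W f) > (1 + \<epsilon>) * \<mu>}) \<le>
      card {f \<in> \<Omega>. \<theta> * card (kept \<pi> W f) \<ge> \<theta> * ((1 + \<epsilon>) * \<mu>)}"
    using finite_thinnings \<epsilon> by (intro of_nat_mono card_mono) (auto simp: \<theta>_def)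
  also have "\<dots> \<le> (\<Sum>f\<in>\<Omega>. exp (\<theta> * card (kept \<pi> W f))) / exp (\<theta> * ((1 + \<epsilon>) * \<mu>))"
    using exp_markov[of "\<theta> * ((1 + \<epsilon>) * \<mu>)" \<theta> W] by (simp add: field_simps)
  also have "\<dots> \<le> exp (real t / s * (exp \<theta> - 1) * card W) * card \<Omega> / exp (\<theta> * ((1 + \<epsilon>) * \<mu>))"
    using sum_exp_card_kept_le[OF W] by (intro divide_right_mono) auto
  also have "\<dots> = exp (real t / s * (exp \<theta> - 1) * card W - \<theta> * ((1 + \<epsilon>) * \<mu>)) * card \<Omega>"
    by (simp add: exp_diff)
  also have "\<dots> \<le> exp (- (\<epsilon>\<^sup>2 * \<mu> / 4)) * card \<Omega>"
    using expo by (intro mult_right_mono) auto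
  finally show ?thesis by (simp add: \<mu>_def)
qed

text \<open>The mirror image, with parameter -\<theta> and a lower bound \<mu> for the mean; the
  estimate needed is now 1 - e^(-\<theta>) \<ge> \<theta> - \<theta>^2.\<close>

lemma chernoff_lower:
  fixes m \<epsilon> :: real
  assumes W: "finite W" "inj_on \<pi> W" "\<And>p. p \<in> W \<Longrightarrow> \<pi> p \<in> V \<and> p \<in> L (\<pi> p)"
    and m: "m \<le> real (card W)" "0 \<le> m" and \<epsilon>: "0 < \<epsilon>" "\<epsilon> \<le> 1"
  shows "real (card {f \<in> \<Omega>. card (kept \<pi> W f) < (1 - \<epsilon>) * (t * m / s)}) \<le>
    exp (- (\<epsilon>\<^sup>2 * (t * m / s) / 4)) * card \<Omega>"
proof -
  define \<mu> where "\<mu> = t * m / s"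
  define \<theta> where "\<theta> = \<epsilon> / 2"
  have \<mu>: "\<mu> \<ge> 0" using m by (simp add: \<mu>_def)
  have \<theta>: "0 < \<theta>" "\<theta> \<le> 1/2" using \<epsilon> by (auto simp: \<theta>_def)
  have "exp (- \<theta>) \<le> 1 / (1 + \<theta>)"
    using exp_ge_add_one_self[of \<theta>] \<theta> by (simp add: exp_minus field_simps)
  also have "\<dots> \<le> 1 - \<theta> + \<theta>\<^sup>2"
    using \<theta> by (simp add: field_simps power2_eq_square)
  finally have "1 - exp (- \<theta>) \<ge> \<theta> - \<theta>\<^sup>2" by simp
  moreover have "real t / s * card W \<ge> \<mu>"
    using mult_left_mono[OF m(1), of "real t / s"] by (simp add: \<mu>_def)
  ultimately have le: "(1 - exp (- \<theta>)) * (real t / s * card W) \<ge> (\<theta> - \<theta>\<^sup>2) * \<mu>"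
    using \<theta> \<mu> by (intro mult_mono) (auto simp: power2_eq_square)
  have expo: "real t / s * (exp (- \<theta>) - 1) * card W - (- \<theta>) * ((1 - \<epsilon>) * \<mu>) \<le> - (\<epsilon>\<^sup>2 * \<mu> / 4)"
  proof -
    have "real t / s * (exp (- \<theta>) - 1) * card W = - ((1 - exp (- \<theta>)) * (real t / s * card W))"
      by (simp add: algebra_simps diff_divide_distrib)
    also have "\<dots> \<le> - ((\<theta> - \<theta>\<^sup>2) * \<mu>)" using le by simp
    finally show ?thesis by (simp add: \<theta>_def field_simps power2_eq_square)
  qed
  have "real (card {f \<in> \<Omega>. card (kept \<pi> W f) < (1 - \<epsilon>) * \<mu>}) \<le>
      card {f \<in> \<Omega>. (- \<theta>) * card (kept \<pi> W f) \<ge> (- \<theta>) * ((1 - \<epsilon>) * \<mu>)}"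
    using finite_thinnings \<theta> by (intro of_nat_mono card_mono) auto
  also have "\<dots> \<le> (\<Sum>f\<in>\<Omega>. exp ((- \<theta>) * card (kept \<pi> W f))) / exp ((- \<theta>) * ((1 - \<epsilon>) * \<mu>))"
    using exp_markov[of "(- \<theta>) * ((1 - \<epsilon>) * \<mu>)" "- \<theta>" W] by (simp add: field_simps)
  also have "\<dots> \<le> exp (real t / s * (exp (- \<theta>) - 1) * card W) * card \<Omega> / exp ((- \<theta>) * ((1 - \<epsilon>) * \<mu>))"
    using sum_exp_card_kept_le[OF W, of "- \<theta>"] by (intro divide_right_mono) auto
  also have "\<dots> = exp (real t / s * (exp (- \<theta>) - 1) * card W - (- \<theta>) * ((1 - \<epsilon>) * \<mu>)) * card \<Omega>"
    unfolding exp_diff by simp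
  also have "\<dots> \<le> exp (- (\<epsilon>\<^sup>2 * \<mu> / 4)) * card \<Omega>"
    using expo by (intro mult_right_mono) auto
  finally show ?thesis by (simp add: \<mu>_def)
qed

end

text \<open>The local lemma for events that depend only on a survivor count. The event of
  \<open>e\<close> is decided at the vertices of \<open>W e\<close>. It meets at most M s D events:
  at most M elements of \<open>W e\<close>, s candidates at the vertex of each, and at most D sets
  \<open>W e'\<close> through each of those.\<close>

lemma (in thinning) thinning_exists:
  fixes W :: "'e \<Rightarrow> 'p set" and M D p :: real
  assumes J: "finite J"
    and W: "\<And>e. e \<in> J \<Longrightarrow> finite (W e)" "\<And>e. e \<in> J \<Longrightarrow> inj_on \<pi> (W e)"
      "\<And>e q. \<lbrakk>e \<in> J; q \<in> W e\<rbrakk> \<Longrightarrow> \<pi> q \<in> V \<and> q \<in> L (\<pi> q)"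
    and M: "\<And>e. e \<in> J \<Longrightarrow> card (W e) \<le> M"
    and D: "\<And>q. card {e \<in> J. q \<in> W e} \<le> D"
    and bad: "\<And>e. e \<in> J \<Longrightarrow>
      card {f \<in> \<Omega>. bad e (card (kept \<pi> (W e) f))} \<le> p * card \<Omega>"
    and p: "0 \<le> p" "4 * p \<le> 1" "4 * p * (M * s * D) \<le> 1"
  shows "\<exists>f \<in> \<Omega>. \<forall>e \<in> J. \<not> bad e (card (kept \<pi> (W e) f))"
proof -
  define A where "A e = {f \<in> \<Omega>. bad e (card (kept \<pi> (W e) f))}" for e
  have "\<exists>f \<in> \<Omega>. \<forall>e \<in> J. f \<notin> A e"
    unfolding thinnings_def
  proof (rule lovasz_local_lemma[where supp = "\<lambda>e. \<pi> ` W e" and p = p and d = "M * s * D"])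
    show "{T. T \<subseteq> L v \<and> card T = t} \<noteq> {}" if "v \<in> V" for v
      using obtain_subset_with_card_n[of t "L v"] cardL[OF that] t by auto
    show "g \<in> A e" if "e \<in> J" "f \<in> A e" "g \<in> (\<Pi>\<^sub>E v\<in>V. {T. T \<subseteq> L v \<and> card T = t})"
      "\<And>v. v \<in> \<pi> ` W e \<Longrightarrow> f v = g v" for e f g
    proof -
      have "kept \<pi> (W e) f = kept \<pi> (W e) g" using that(4) by (auto simp: kept_def)
      with that show ?thesis by (simp add: A_def thinnings_def)
    qed
    show "real (card (A e)) \<le> p * card (\<Pi>\<^sub>E v\<in>V. {T. T \<subseteq> L v \<and> card T = t})" if "e \<in> J" for e
      using bad[OF that] by (simp add: A_def thinnings_def)
    show "real (card {e' \<in> J. \<pi> ` W e \<inter> \<pi> ` W e' \<noteq> {}}) \<le> M * s * D" if e: "e \<in> J" for e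
    proof -
      have D0: "D \<ge> 0" using D[of undefined] by linarith
      have "{e' \<in> J. \<pi> ` W e \<inter> \<pi> ` W e' \<noteq> {}} \<subseteq> (\<Union>q\<in>W e. \<Union>q'\<in>L (\<pi> q). {e' \<in> J. q' \<in> W e'})"
      proof (rule subsetI)
        fix e' assume "e' \<in> {e' \<in> J. \<pi> ` W e \<inter> \<pi> ` W e' \<noteq> {}}"
        then obtain q q' where *: "e' \<in> J" "q \<in> W e" "q' \<in> W e'" "\<pi> q = \<pi> q'" by blast
        then have "q' \<in> L (\<pi> q)" using W(3)[of e' q'] by simp
        with * show "e' \<in> (\<Union>q\<in>W e. \<Union>q'\<in>L (\<pi> q). {e' \<in> J. q' \<in> W e'})" by blast
      qed
      then have "card {e' \<in> J. \<pi> ` W e \<inter> \<pi> ` W e' \<noteq> {}} \<le>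
          card (\<Union>q\<in>W e. \<Union>q'\<in>L (\<pi> q). {e' \<in> J. q' \<in> W e'})"
        using W e J finL by (intro card_mono) auto
      also have "\<dots> \<le> (\<Sum>q\<in>W e. card (\<Union>q'\<in>L (\<pi> q). {e' \<in> J. q' \<in> W e'}))"
        using W e by (intro card_UN_le) auto
      also have "\<dots> \<le> (\<Sum>q\<in>W e. \<Sum>q'\<in>L (\<pi> q). card {e' \<in> J. q' \<in> W e'})"
        using W e finL by (intro sum_mono card_UN_le) auto
      finally have "real (card {e' \<in> J. \<pi> ` W e \<inter> \<pi> ` W e' \<noteq> {}}) \<le>
          (\<Sum>q\<in>W e. \<Sum>q'\<in>L (\<pi> q). real (card {e' \<in> J. q' \<in> W e'}))"
        by (simp flip: of_nat_sum)
      also have "\<dots> \<le> (\<Sum>q\<in>W e. \<Sum>q'\<in>L (\<pi> q). D)" by (intro sum_mono D)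
      also have "\<dots> = card (W e) * (s * D)" using W(3)[OF e] cardL by simp
      also have "\<dots> \<le> M * (s * D)" using M[OF e] D0 by (intro mult_right_mono) auto
      finally show ?thesis by (simp add: mult.assoc)
    qed
  qed (use finV finL J p in \<open>auto simp: A_def thinnings_def\<close>)
  then show ?thesis by (auto simp: A_def)
qed

section \<open>Cover systems: the final choice and one thinning stage\<close>

text \<open>
  \<open>P\<close> is the set of surviving candidates, \<open>\<pi>\<close> sends a candidate to its vertex, and \<open>N p\<close> is the set
  of candidates that may follow \<open>p\<close>. The elements of \<open>Z\<close> are never removed and are not constrained
  by the choice; they only demand that some chosen candidate lies in \<open>N z\<close>, which is how
  colours are prevented from dying out. Having \<open>\<pi>\<close> injective on in- and out-neighbourhoods makes
  the survivals counted by a degree independent.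
\<close>

locale cover_system =
  fixes P Z :: "'p set" and \<pi> :: "'p \<Rightarrow> 'v" and N :: "'p \<Rightarrow> 'p set" and s :: nat and m M :: real
  assumes finP: "finite P" and finZ: "finite Z"
    and s_pos: "s \<ge> 1" and m_pos: "0 < m" and mM: "m \<le> M"
    and fibre: "\<And>v. v \<in> \<pi> ` P \<Longrightarrow> card {p \<in> P. \<pi> p = v} = s"
    and N_subset: "\<And>p. p \<in> P \<union> Z \<Longrightarrow> N p \<subseteq> P"
    and inj_out: "\<And>p. p \<in> P \<union> Z \<Longrightarrow> inj_on \<pi> (N p)"
    and outdeg: "\<And>p. p \<in> P \<union> Z \<Longrightarrow> m \<le> card (N p)" "\<And>p. p \<in> P \<union> Z \<Longrightarrow> card (N p) \<le> M"
    and inj_in: "\<And>q. q \<in> P \<Longrightarrow> inj_on \<pi> {p \<in> P. q \<in> N p}"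
    and indeg: "\<And>q. q \<in> P \<Longrightarrow> card {p \<in> P. q \<in> N p} \<le> M"
    and indeg_Z: "\<And>q. q \<in> P \<Longrightarrow> card {z \<in> Z. q \<in> N z} \<le> 1"
begin

definition "fib v = {p \<in> P. \<pi> p = v}"

lemma thinning: "1 \<le> t \<Longrightarrow> t \<le> s \<Longrightarrow> thinning (\<pi> ` P) fib s t"
  by unfold_locales (use finP fibre in \<open>auto simp: fib_def\<close>)

lemma in_fib: "q \<in> P \<Longrightarrow> \<pi> q \<in> \<pi> ` P \<and> q \<in> fib (\<pi> q)"
  by (auto simp: fib_def)

lemma finite_N: "p \<in> P \<union> Z \<Longrightarrow> finite (N p)"
  using N_subset finP finite_subset by blast

lemma kept_eq: "W \<subseteq> P \<Longrightarrow> kept \<pi> W f = W \<inter> kept \<pi> P f"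
  by (auto simp: kept_def)

lemma indeg_all: "card {p \<in> P \<union> Z. q \<in> N p} \<le> M + 1"
proof (cases "q \<in> P")
  case True
  have "card {p \<in> P \<union> Z. q \<in> N p} \<le> card ({p \<in> P. q \<in> N p} \<union> {z \<in> Z. q \<in> N z})"
    using finP finZ by (intro card_mono) auto
  also have "\<dots> \<le> card {p \<in> P. q \<in> N p} + card {z \<in> Z. q \<in> N z}" by (rule card_Un_le)
  finally show ?thesis using indeg[OF True] indeg_Z[OF True] by linarith
next
  case False
  then have none: "{p \<in> P \<union> Z. q \<in> N p} = {}" using N_subset by blast
  show ?thesis unfolding none using m_pos mM by simp
qed

lemma kept_fibre:
  assumes "f \<in> thinnings (\<pi> ` P) fib t" "v \<in> \<pi> ` P"
  shows "{p \<in> kept \<pi> P f. \<pi> p = v} = f v" "card (f v) = t"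
proof -
  have f: "f v \<subseteq> fib v" "card (f v) = t" using assms by (auto simp: thinnings_def PiE_iff)
  then show "{p \<in> kept \<pi> P f. \<pi> p = v} = f v" "card (f v) = t" by (auto simp: kept_def fib_def)
qed

text \<open>Choose a single candidate at every vertex, that is, thin to t = 1. No element of
  \<open>N p\<close> is chosen with probability at most e^(-m/s). The constant 8 is the 4 of the
  local lemma times 2, from M + 1 \<le> 2M.\<close>

lemma section_of_small_fibres:
  assumes M: "M \<ge> 1" and small: "8 * real s * M\<^sup>2 * exp (- (m / s)) \<le> 1"
  shows "\<exists>S \<subseteq> P. inj_on \<pi> S \<and> (\<forall>p \<in> S \<union> Z. N p \<inter> S \<noteq> {})"
proof -
  interpret thinning "\<pi> ` P" fib \<pi> s 1 using s_pos by (intro thinning) auto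
  \<comment> \<open>Which candidates will be chosen is not known beforehand, so a chosen successor
    is demanded for every p in \<open>P\<close>.\<close>
  have "\<exists>f \<in> \<Omega>. \<forall>p \<in> P \<union> Z. \<not> card (kept \<pi> (N p) f) = 0"
  proof (rule thinning_exists[where M = M and D = "M + 1" and p = "exp (- (m / s))"])
    have "4 * exp (- (m / s)) * (M * s * (M + 1)) \<le> 4 * exp (- (m / s)) * (M * s * (2 * M))"
      using M by (intro mult_left_mono) auto
    also have "\<dots> \<le> 1" using small by (simp add: power2_eq_square mult_ac)
    finally show *: "4 * exp (- (m / s)) * (M * s * (M + 1)) \<le> 1" .
    have "1 \<le> M * s * (M + 1)" using M s_pos mult_mono[of 1 M 1 "real s"]
        mult_mono[of 1 "M * s" 1 "M + 1"] by simp
    then have "4 * exp (- (m / s)) * 1 \<le> 4 * exp (- (m / s)) * (M * s * (M + 1))"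
      by (intro mult_left_mono) auto
    with * show "4 * exp (- (m / s)) \<le> 1" by linarith
    show "card {f \<in> \<Omega>. card (kept \<pi> (N p) f) = 0} \<le> exp (- (m / s)) * card \<Omega>" if "p \<in> P \<union> Z" for p
      using card_kept_eq_0_tail[OF finite_N[OF that] inj_out[OF that] _ outdeg(1)[OF that]]
        N_subset[OF that] in_fib by auto
  qed (use finP finZ finite_N inj_out N_subset in_fib outdeg indeg_all in \<open>auto simp: subset_iff\<close>)
  then obtain f where f: "f \<in> \<Omega>" "\<And>p. p \<in> P \<union> Z \<Longrightarrow> card (kept \<pi> (N p) f) \<noteq> 0" by blast
  define S where "S = kept \<pi> P f"
  have S: "S \<subseteq> P" by (auto simp: S_def kept_def)
  moreover have "inj_on \<pi> S"
  proof (rule inj_onI)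
    fix p q assume pq: "p \<in> S" "q \<in> S" "\<pi> p = \<pi> q"
    then have "p \<in> f (\<pi> p)" "q \<in> f (\<pi> p)" by (auto simp: S_def kept_def)
    moreover have "card (f (\<pi> p)) = 1" using kept_fibre(2)[OF f(1)] S pq by blast
    ultimately show "p = q" by (metis card_1_singletonE singletonD)
  qed
  moreover have "N p \<inter> S \<noteq> {}" if "p \<in> S \<union> Z" for p
    using f(2)[of p] kept_eq[OF N_subset, of p f] S that by (auto simp: S_def)
  ultimately show ?thesis by blast
qed

text \<open>All out-degrees and in-degrees are kept near their expected values at once. The constant
  24 is 4 from the local lemma, times 2 for the two tails, times 3 because a candidate lies in at
  most (M + 1) + M \<le> 3M of the neighbourhoods considered.\<close>

lemma thin:
  assumes M: "M \<ge> 1" and t: "1 \<le> t" "t \<le> s" and \<epsilon>: "0 < \<epsilon>" "\<epsilon> < 1"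
    and small: "24 * real s * M\<^sup>2 * exp (- (\<epsilon>\<^sup>2 * (t * m / s) / 4)) \<le> 1"
  shows "\<exists>P' \<subseteq> P. cover_system P' Z \<pi> (\<lambda>p. N p \<inter> P') t ((1 - \<epsilon>) * (t * m / s)) ((1 + \<epsilon>) * (t * M / s))"
proof -
  interpret thinning "\<pi> ` P" fib \<pi> s t using t by (rule thinning)
  define m' M' where "m' = (1 - \<epsilon>) * (t * m / s)" and "M' = (1 + \<epsilon>) * (t * M / s)"
  define pr where "pr = exp (- (\<epsilon>\<^sup>2 * (t * m / s) / 4))"
  \<comment> \<open>\<open>Inl p\<close> stands for the out-neighbourhood of \<open>p\<close> and
    \<open>Inr q\<close> for the in-neighbourhood of \<open>q\<close> inside \<open>P\<close>. Both
    need the upper tail, only the former the lower tail.\<close>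
  define J :: "('p + 'p) set" where "J = Inl ` (P \<union> Z) \<union> Inr ` P"
  define W where "W = (\<lambda>e. case e of Inl p \<Rightarrow> N p | Inr q \<Rightarrow> {p \<in> P. q \<in> N p})"
  define bad where "bad = (\<lambda>(e :: 'p + 'p) n. real n > M' \<or> (\<exists>p. e = Inl p \<and> real n < m'))"
  have W_P: "W e \<subseteq> P" if "e \<in> J" for e
  proof (cases e)
    case (Inl p)
    then have "p \<in> P \<union> Z" using that by (auto simp: J_def)
    from N_subset[OF this] Inl show ?thesis by (simp add: W_def)
  qed (auto simp: W_def)
  have W_inj: "inj_on \<pi> (W e)" if "e \<in> J" for e
    using that inj_out inj_in by (auto simp: W_def J_def)
  have W_M: "card (W e) \<le> M" if "e \<in> J" for e using that outdeg indeg by (auto simp: W_def J_def)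
  have W_fib: "\<pi> q \<in> \<pi> ` P \<and> q \<in> fib (\<pi> q)" if "e \<in> J" "q \<in> W e" for e q
    using W_P that in_fib by blast
  have W_fin: "finite (W e)" if "e \<in> J" for e using W_P[OF that] finP finite_subset by blast
  have s: "s > 0" using s_pos by simp
  have "\<exists>f \<in> \<Omega>. \<forall>e \<in> J. \<not> bad e (card (kept \<pi> (W e) f))"
  proof (rule thinning_exists[where M = M and D = "3 * M" and p = "2 * pr"])
    show "finite J" using finP finZ by (simp add: J_def)
    show "real (card {e \<in> J. q \<in> W e}) \<le> 3 * M" for q
    proof (cases "q \<in> P")
      case True
      have "card {e \<in> J. q \<in> W e} \<le> card (Inl ` {p \<in> P \<union> Z. q \<in> N p} \<union> (Inr ` N q :: ('p + 'p) set))"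
        using finP finZ finite_N True by (intro card_mono) (auto simp: J_def W_def)
      also have "\<dots> \<le> card (Inl ` {p \<in> P \<union> Z. q \<in> N p} :: ('p + 'p) set) + card (Inr ` N q :: ('p + 'p) set)"
        by (rule card_Un_le)
      also have "\<dots> = card {p \<in> P \<union> Z. q \<in> N p} + card (N q)" by (simp add: card_image)
      finally show ?thesis using indeg_all[of q] outdeg(2)[of q] True M by auto
    next
      case False
      then have none: "{e \<in> J. q \<in> W e} = {}" using W_P by blast
      show ?thesis unfolding none using M by simp
    qed
    show "real (card {f \<in> \<Omega>. bad e (card (kept \<pi> (W e) f))}) \<le> 2 * pr * card \<Omega>" if e: "e \<in> J" for e
    proof -
      have "real (card {f \<in> \<Omega>. card (kept \<pi> (W e) f) > M'}) \<le>
          exp (- (\<epsilon>\<^sup>2 * (t * M / s) / 4)) * card \<Omega>"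
        unfolding M'_def using chernoff_upper[OF W_fin W_inj W_fib W_M, OF e e e _ e] \<epsilon> by simp
      also have "\<dots> \<le> pr * card \<Omega>"
        unfolding pr_def using mM \<epsilon> t by (intro mult_right_mono) (auto intro!: divide_right_mono mult_left_mono)
      finally have up: "real (card {f \<in> \<Omega>. card (kept \<pi> (W e) f) > M'}) \<le> pr * card \<Omega>" .
      show ?thesis
      proof (cases e)
        case (Inl p)
        then have p: "p \<in> P \<union> Z" "W e = N p" using e by (auto simp: J_def W_def)
        have low: "real (card {f \<in> \<Omega>. card (kept \<pi> (W e) f) < m'}) \<le> pr * card \<Omega>"
          unfolding m'_def pr_def using m_pos \<epsilon> outdeg(1)[OF p(1)] p(2)
          by (intro chernoff_lower[OF W_fin W_inj W_fib, OF e e e]) auto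
        have split: "{f \<in> \<Omega>. bad e (card (kept \<pi> (W e) f))} =
            {f \<in> \<Omega>. card (kept \<pi> (W e) f) > M'} \<union> {f \<in> \<Omega>. card (kept \<pi> (W e) f) < m'}"
          using Inl by (auto simp: bad_def)
        have "card {f \<in> \<Omega>. bad e (card (kept \<pi> (W e) f))} \<le>
            card {f \<in> \<Omega>. card (kept \<pi> (W e) f) > M'} + card {f \<in> \<Omega>. card (kept \<pi> (W e) f) < m'}"
          unfolding split by (rule card_Un_le)
        with up low show ?thesis by linarith
      next
        case (Inr q)
        then have same: "{f \<in> \<Omega>. bad e (card (kept \<pi> (W e) f))} = {f \<in> \<Omega>. card (kept \<pi> (W e) f) > M'}"
          by (auto simp: bad_def)
        have "0 \<le> pr * card \<Omega>" by (simp add: pr_def)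
        then show ?thesis unfolding same using up by linarith
      qed
    qed
    show *: "4 * (2 * pr) * (M * s * (3 * M)) \<le> 1"
      using small by (simp add: pr_def power2_eq_square mult_ac)
    have "1 \<le> M * s * (3 * M)" using M s_pos mult_mono[of 1 M 1 "real s"]
        mult_mono[of 1 "M * s" 1 "3 * M"] by simp
    then have "4 * (2 * pr) * 1 \<le> 4 * (2 * pr) * (M * s * (3 * M))"
      by (intro mult_left_mono) (auto simp: pr_def)
    with * show "4 * (2 * pr) \<le> 1" by linarith
  qed (use W_fin W_inj W_fib W_M in \<open>auto simp: pr_def\<close>)
  then obtain f where f: "f \<in> \<Omega>" "\<And>e. e \<in> J \<Longrightarrow> \<not> bad e (card (kept \<pi> (W e) f))" by blast
  define P' where "P' = kept \<pi> P f"
  have P': "P' \<subseteq> P" by (auto simp: P'_def kept_def)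
  have W': "card (W e \<inter> P') \<le> M'" if "e \<in> J" for e
    using f(2)[OF that] kept_eq[OF W_P[OF that], of f] by (auto simp: bad_def P'_def)
  have "cover_system P' Z \<pi> (\<lambda>p. N p \<inter> P') t m' M'"
  proof
    show "finite P'" using P' finP finite_subset by blast
    show "finite Z" by (rule finZ)
    show "1 \<le> t" by (rule t)
    show "0 < m'" using \<epsilon> m_pos s t by (simp add: m'_def)
    show "m' \<le> M'" unfolding m'_def M'_def
      using mM m_pos \<epsilon> by (intro mult_mono divide_right_mono mult_left_mono) auto
    show "card {p \<in> P'. \<pi> p = v} = t" if "v \<in> \<pi> ` P'" for v
      using kept_fibre[OF f(1), of v] that P' by (auto simp: P'_def)
    fix p assume p: "p \<in> P' \<union> Z"
    then have p': "p \<in> P \<union> Z" using P' by blast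
    show "N p \<inter> P' \<subseteq> P'" by blast
    show "inj_on \<pi> (N p \<inter> P')" using inj_out[OF p'] by (rule inj_on_subset) blast
    have e: "Inl p \<in> J" using p' by (auto simp: J_def)
    show "m' \<le> card (N p \<inter> P')"
      using f(2)[OF e] kept_eq[OF W_P[OF e], of f] by (auto simp: bad_def P'_def W_def)
    show "card (N p \<inter> P') \<le> M'" using W'[OF e] by (simp add: W_def)
  next
    fix q assume "q \<in> P'"
    then have q: "q \<in> P" "Inr q \<in> J" using P' by (auto simp: J_def)
    show "inj_on \<pi> {p \<in> P'. q \<in> N p \<inter> P'}" using inj_in[OF q(1)] P' by (elim inj_on_subset) auto
    have "card {p \<in> P'. q \<in> N p \<inter> P'} \<le> card (W (Inr q) \<inter> P')"
      using W_fin[OF q(2)] P' by (intro card_mono) (auto simp: W_def)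
    also note W'[OF q(2)]
    finally show "card {p \<in> P'. q \<in> N p \<inter> P'} \<le> M'" by simp
    have "card {z \<in> Z. q \<in> N z \<inter> P'} \<le> card {z \<in> Z. q \<in> N z}"
      using finZ by (intro card_mono) auto
    with indeg_Z[OF q(1)] show "card {z \<in> Z. q \<in> N z \<inter> P'} \<le> 1" by simp
  qed
  with P' show ?thesis unfolding m'_def M'_def by blast
qed

end

section \<open>Numerical conditions along the stages\<close>

text \<open>With x = m/s, the hypothesis says c M \<le> x^2 s, so M is bounded polynomially in x and
  s. The exponential in the local lemma condition then has to beat only powers of x and s, which
  removes the logarithm of the degree.\<close>

lemma degree_ratio:
  fixes c m M s :: real
  assumes "0 < m" "m \<le> M" "0 < s" "0 < c" and MS: "c * (M * s) \<le> m\<^sup>2"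
  shows "c \<le> m / s" "s * M\<^sup>2 \<le> (m / s) ^ 4 * s ^ 3 / c\<^sup>2"
proof -
  define x where "x = m / s"
  have m: "m = x * s" using assms by (simp add: x_def)
  have x: "x > 0" using assms by (simp add: x_def)
  have "c * (m * s) \<le> c * (M * s)" using assms by (intro mult_left_mono mult_right_mono) auto
  with MS have "m * (c * s) \<le> m * m" by (simp add: power2_eq_square mult_ac)
  then show "c \<le> m / s" using assms by (simp add: field_simps)
  have "(c * M) * s \<le> (x\<^sup>2 * s) * s" using MS by (simp add: m power2_eq_square mult_ac)
  then have "c * M \<le> x\<^sup>2 * s" using assms by simp
  then have "(c * M)\<^sup>2 \<le> (x\<^sup>2 * s)\<^sup>2" using assms by (intro power_mono) auto
  then have "s * (c * M)\<^sup>2 \<le> s * (x\<^sup>2 * s)\<^sup>2" using assms by (intro mult_left_mono) auto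
  then show "s * M\<^sup>2 \<le> (m / s) ^ 4 * s ^ 3 / c\<^sup>2"
    using assms by (simp add: x_def[symmetric] field_simps power_mult_distrib eval_nat_numeral)
qed

text \<open>Here x = m/s \<ge> 50, and e^x \<ge> (1 + x/100)^100. Of the 100 factors, 4 absorb x^4
  and the other 96, each at least 3/2, absorb the constants.\<close>

lemma small_fibres_numeric:
  fixes m M s :: real
  assumes "0 < m" "m \<le> M" "1 \<le> s" "s \<le> 4096" "50 * (M * s) \<le> m\<^sup>2"
  shows "8 * s * M\<^sup>2 * exp (- (m / s)) \<le> 1"
proof -
  define x where "x = m / s"
  have x: "50 \<le> x" and sM: "s * M\<^sup>2 \<le> x ^ 4 * s ^ 3 / 2500"
    using degree_ratio[of m M s 50] assms by (auto simp: x_def)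
  have "s ^ 3 \<le> 4096 ^ 3" using assms by (intro power_mono) auto
  then have "x ^ 4 * s ^ 3 \<le> x ^ 4 * 4096 ^ 3" by (intro mult_left_mono) auto
  with sM have "8 * (s * M\<^sup>2) \<le> x ^ 4 * (8 * 4096 ^ 3 / 2500)" by simp
  also have "\<dots> \<le> x ^ 4 * ((3/2) ^ 96 / 100 ^ 4)" by (intro mult_left_mono) (auto simp: power_divide)
  also have "\<dots> = (3/2) ^ 96 * (x / 100) ^ 4" by (simp add: power_divide)
  also have "\<dots> \<le> (1 + x / 100) ^ 96 * (1 + x / 100) ^ 4"
    using x by (intro mult_mono power_mono) auto
  also have "\<dots> = (1 + x / 100) ^ 100" by (simp flip: power_add)
  also have "\<dots> \<le> exp x" using exp_ge_one_plus_x_over_n_power_n[of 100 x] x by simp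
  finally show ?thesis by (simp add: exp_minus field_simps flip: x_def)
qed

text \<open>The condition of \<open>thin\<close> for t = b^4 and \<epsilon> = 1/b, whose exponent is
  y = b^2 x/4. The left side is of order b^24 x^4, while e^y \<ge> (y/16)^16 = b^32 x^16 / 64^16;
  the spare b^8 x^12 is at least 8^8 109^12.\<close>

lemma thinning_numeric:
  fixes b m M s :: real
  assumes "0 < m" "m \<le> M" "1 \<le> s" "8 \<le> b" "s \<le> b ^ 8" "109 * (M * s) \<le> m\<^sup>2"
  shows "24 * s * M\<^sup>2 * exp (- ((1 / b)\<^sup>2 * (b ^ 4 * m / s) / 4)) \<le> 1"
proof -
  define x where "x = m / s"
  define y where "y = b\<^sup>2 * x / 4"
  have x: "109 \<le> x" and sM: "s * M\<^sup>2 \<le> x ^ 4 * s ^ 3 / 11881"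
    using degree_ratio[of m M s 109] assms by (auto simp: x_def)
  have y0: "y \<ge> 0" using x by (simp add: y_def)
  have "s ^ 3 \<le> (b ^ 8) ^ 3" using assms by (intro power_mono) auto
  then have "x ^ 4 * s ^ 3 \<le> x ^ 4 * (b ^ 8) ^ 3" by (intro mult_left_mono) auto
  with sM have "24 * (s * M\<^sup>2) \<le> b ^ 24 * x ^ 4 * (24 / 11881)" by (simp add: power_mult[symmetric])
  also have "\<dots> \<le> b ^ 24 * x ^ 4 * (8 ^ 8 * 109 ^ 12 / 64 ^ 16)"
    by (intro mult_left_mono) auto
  also have "\<dots> \<le> b ^ 24 * x ^ 4 * (b ^ 8 * x ^ 12 / 64 ^ 16)"
    using assms x by (intro mult_left_mono divide_right_mono mult_mono power_mono) auto
  also have "\<dots> = (b ^ 24 * b ^ 8) * (x ^ 4 * x ^ 12) / 64 ^ 16"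
    by (simp only: mult_ac times_divide_eq_right)
  also have "\<dots> = (b\<^sup>2) ^ 16 * x ^ 16 / 64 ^ 16" by (simp flip: power_add power_mult)
  also have "\<dots> = (y / 16) ^ 16" by (simp add: y_def power_mult_distrib power_divide)
  also have "\<dots> \<le> (1 + y / 16) ^ 16" using y0 by (intro power_mono) auto
  also have "\<dots> \<le> exp y" using exp_ge_one_plus_x_over_n_power_n[of 16 y] y0 by simp
  finally have "24 * (s * M\<^sup>2) * exp (- y) \<le> 1" by (simp add: exp_minus field_simps)
  moreover have "(1 / b)\<^sup>2 * (b ^ 4 * m / s) / 4 = y"
    using assms by (simp add: y_def x_def field_simps eval_nat_numeral)
  ultimately show ?thesis by (simp add: mult.assoc)
qed

text \<open>One thinning multiplies m^2/(M s) by (1 - \<epsilon>)^2/(1 + \<epsilon>). Passing from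
  size parameter b^2 to b, with \<epsilon> = 1/b, lowers the slack from (1 - 2\<epsilon>^2)^3 to (1
  - 2\<epsilon>)^3, and this pays for that loss.\<close>

lemma slack_step:
  fixes \<epsilon> :: real
  assumes "0 < \<epsilon>" "\<epsilon> \<le> 1/4"
  shows "(1 - 2 * \<epsilon>) ^ 3 * (1 + \<epsilon>) \<le> (1 - \<epsilon>)\<^sup>2 * (1 - 2 * \<epsilon>\<^sup>2) ^ 3"
proof -
  have e2: "\<epsilon>\<^sup>2 \<le> \<epsilon> * (1/4)" unfolding power2_eq_square using assms by (intro mult_left_mono) auto
  have "1 - 2 * \<epsilon> \<le> (1 - \<epsilon>) * (1 - 2 * \<epsilon>\<^sup>2)"
  proof -
    have "(1 - \<epsilon>) * (1 - 2 * \<epsilon>\<^sup>2) - (1 - 2 * \<epsilon>) = \<epsilon> - 2 * \<epsilon>\<^sup>2 + 2 * (\<epsilon> * \<epsilon>\<^sup>2)"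
      by (simp add: algebra_simps)
    moreover have "0 \<le> \<epsilon> * \<epsilon>\<^sup>2" using assms by simp
    ultimately show ?thesis using e2 assms by linarith
  qed
  then have "(1 - 2 * \<epsilon>) ^ 3 \<le> ((1 - \<epsilon>) * (1 - 2 * \<epsilon>\<^sup>2)) ^ 3"
    using assms by (intro power_mono) auto
  then have "(1 - 2 * \<epsilon>) ^ 3 * (1 + \<epsilon>) \<le> ((1 - \<epsilon>) * (1 - 2 * \<epsilon>\<^sup>2)) ^ 3 * (1 + \<epsilon>)"
    using assms by (intro mult_right_mono) auto
  also have "\<dots> = (1 - \<epsilon>)\<^sup>2 * (1 - 2 * \<epsilon>\<^sup>2) ^ 3 * (1 - \<epsilon>\<^sup>2)"
    by (simp add: power_mult_distrib) (simp add: power2_eq_square power3_eq_cube algebra_simps)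
  also have "\<dots> \<le> (1 - \<epsilon>)\<^sup>2 * (1 - 2 * \<epsilon>\<^sup>2) ^ 3 * 1"
    using assms e2 by (intro mult_left_mono) auto
  finally show ?thesis by simp
qed

text \<open>
  The size bounds \<open>b\<^sup>4\<close> with \<open>b = 8, 64, 4096, \<dots>\<close> are successive squares. Thinning from at most \<open>b\<^sup>8\<close>
  to exactly \<open>b\<^sup>4\<close> candidates has relative error \<open>1 / b\<close>; the factor \<open>(1 - 2 / b) ^ 3\<close> is the slack that
  absorbs all the errors still to come.
\<close>

lemma section_exists_aux:
  fixes b :: nat
  assumes "cover_system P Z \<pi> N s m M" "b = 8 ^ 2 ^ j" "s \<le> b ^ 4"
    "120 * (1 - 2 / b) ^ 3 * (M * s) \<le> m\<^sup>2"
  shows "\<exists>S \<subseteq> P. inj_on \<pi> S \<and> (\<forall>p \<in> S \<union> Z. N p \<inter> S \<noteq> {})"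
  using assms
proof (induction j arbitrary: b P N s m M)
  case (0 b P N s m M)
  interpret cover_system P Z \<pi> N s m M by (rule 0)
  have MS: "M * s > 0" using m_pos mM s_pos by simp
  \<comment> \<open>For b = 8 the slack leaves 120 (3/4)^3 = 50.625, and the lists have at most 8^4
    = 4096 candidates.\<close>
  then have 50: "50 * (M * s) \<le> m\<^sup>2" using 0 by (simp add: power_divide power3_eq_cube)
  have "50 \<le> m / s" using degree_ratio(1)[of m M s 50] 50 m_pos mM s_pos by simp
  also have "m / s \<le> M / 1" using m_pos mM s_pos by (intro frac_le) auto
  finally have M1: "1 \<le> M" by simp
  have "real s \<le> 4096" using 0 by simp
  then show ?case
    using 50 m_pos mM s_pos by (intro section_of_small_fibres[OF M1 small_fibres_numeric]) auto
next
  case (Suc j b' P N s m M)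
  interpret cover_system P Z \<pi> N s m M by (rule Suc)
  define b :: nat where "b = 8 ^ 2 ^ j"
  have b': "b' = b\<^sup>2" using Suc.prems(2) by (simp add: b_def power_mult[symmetric] mult.commute)
  have "(8::nat) ^ 1 \<le> 8 ^ 2 ^ j" by (intro power_increasing) auto
  then have b8: "8 \<le> b" by (simp add: b_def)
  have MS: "M * s > 0" using m_pos mM s_pos by simp
  define \<epsilon> where "\<epsilon> = 1 / real b"
  have \<epsilon>: "0 < \<epsilon>" "\<epsilon> \<le> 1/8" using b8 by (auto simp: \<epsilon>_def field_simps)
  have \<epsilon>2: "\<epsilon>\<^sup>2 \<le> (1/8)\<^sup>2" using \<epsilon> by (intro power_mono) auto
  have slack: "120 * (1 - 2 * \<epsilon>\<^sup>2) ^ 3 * (M * s) \<le> m\<^sup>2"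
    using Suc.prems(4) by (simp add: b' \<epsilon>_def power_divide)
  \<comment> \<open>As b \<ge> 8, at least 120 (62/64)^3 > 109 is left, the constant in
    \<open>thinning_numeric\<close>.\<close>
  have "(62/64 :: real) ^ 3 \<le> (1 - 2 * \<epsilon>\<^sup>2) ^ 3"
    using \<epsilon>2 by (intro power_mono) (auto simp: power_divide)
  then have "109 * (M * s) \<le> 120 * (1 - 2 * \<epsilon>\<^sup>2) ^ 3 * (M * s)"
    using MS by (intro mult_right_mono) (auto simp: power_divide)
  with slack have 109: "109 * (M * s) \<le> m\<^sup>2" by linarith
  show ?case
  proof (cases "s \<le> b ^ 4")
    \<comment> \<open>The lists already meet the next size bound, so the stage is skipped; the
      required slack only becomes weaker.\<close>
    case True
    have "120 * (1 - 2 * \<epsilon>) ^ 3 * (M * s) \<le> 120 * (1 - 2 * \<epsilon>\<^sup>2) ^ 3 * (M * s)"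
    proof (intro mult_right_mono mult_left_mono power_mono)
      show "1 - 2 * \<epsilon> \<le> 1 - 2 * \<epsilon>\<^sup>2"
        using \<epsilon> by (simp add: power2_eq_square mult_left_le)
    qed (use \<epsilon> MS in auto)
    with slack have "120 * (1 - 2 * \<epsilon>) ^ 3 * (M * s) \<le> m\<^sup>2" by linarith
    then show ?thesis
      by (intro Suc.IH[OF Suc.prems(1) b_def True]) (simp add: \<epsilon>_def)
  next
    case False
    have "109 \<le> m / s" using degree_ratio(1)[of m M s 109] 109 m_pos mM s_pos by simp
    also have "m / s \<le> M / 1" using m_pos mM s_pos by (intro frac_le) auto
    finally have M1: "1 \<le> M" by simp
    have sb: "real s \<le> real b ^ 8" using Suc.prems(3) by (simp add: b' power_mult[symmetric])
    have "24 * real s * M\<^sup>2 * exp (- (\<epsilon>\<^sup>2 * (real b ^ 4 * m / s) / 4)) \<le> 1"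
      using thinning_numeric[of m M s b] m_pos mM s_pos b8 sb 109 by (simp add: \<epsilon>_def)
    moreover have "1 \<le> b ^ 4" using b8 by simp
    ultimately obtain P' where P': "P' \<subseteq> P"
      "cover_system P' Z \<pi> (\<lambda>p. N p \<inter> P') (b ^ 4) ((1 - \<epsilon>) * (real b ^ 4 * m / s)) ((1 + \<epsilon>) * (real b ^ 4 * M / s))"
      using thin[of "b ^ 4" \<epsilon>] M1 False \<epsilon> by auto
    define q where "q = real b ^ 4 / s"
    have q: "real b ^ 4 * M / s * real b ^ 4 = q\<^sup>2 * (M * s)"
      using s_pos by (simp add: q_def power2_eq_square)
    have "120 * (1 - 2 / b) ^ 3 * ((1 + \<epsilon>) * (real b ^ 4 * M / s) * real b ^ 4) =
        120 * (1 - 2 * \<epsilon>) ^ 3 * ((1 + \<epsilon>) * (real b ^ 4 * M / s * real b ^ 4))"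
      by (simp add: \<epsilon>_def)
    also have "\<dots> = ((1 - 2 * \<epsilon>) ^ 3 * (1 + \<epsilon>)) * (120 * q\<^sup>2 * (M * s))"
      unfolding q by (simp only: mult_ac)
    also have "\<dots> \<le> ((1 - \<epsilon>)\<^sup>2 * (1 - 2 * \<epsilon>\<^sup>2) ^ 3) * (120 * q\<^sup>2 * (M * s))"
      using MS \<epsilon> by (intro mult_right_mono slack_step) auto
    also have "\<dots> = (1 - \<epsilon>)\<^sup>2 * q\<^sup>2 * (120 * (1 - 2 * \<epsilon>\<^sup>2) ^ 3 * (M * s))" by simp
    also have "\<dots> \<le> (1 - \<epsilon>)\<^sup>2 * q\<^sup>2 * m\<^sup>2" by (intro mult_left_mono slack) auto
    also have "\<dots> = ((1 - \<epsilon>) * (real b ^ 4 * m / s))\<^sup>2"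
      by (simp add: q_def power_mult_distrib power_divide)
    finally obtain S where S: "S \<subseteq> P'" "inj_on \<pi> S" "\<forall>p \<in> S \<union> Z. N p \<inter> P' \<inter> S \<noteq> {}"
      using Suc.IH[OF P'(2) b_def order_refl] unfolding of_nat_power by blast
    then have "S \<subseteq> P \<and> inj_on \<pi> S \<and> (\<forall>p \<in> S \<union> Z. N p \<inter> S \<noteq> {})" using P'(1) by blast
    then show ?thesis by blast
  qed
qed

lemma (in cover_system) section_exists:
  assumes "120 * (M * s) \<le> m\<^sup>2"
  shows "\<exists>S \<subseteq> P. inj_on \<pi> S \<and> (\<forall>p \<in> S \<union> Z. N p \<inter> S \<noteq> {})"
proof -
  \<comment> \<open>The number of stages is immaterial, so j = s is a convenient choice that makes
    b^4 exceed the list size; the slack factor is at most 1.\<close>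
  define b :: nat where "b = 8 ^ 2 ^ s"
  have "s < 2 ^ s" by (rule less_exp)
  also have "(2::nat) ^ s < 2 ^ 2 ^ s" by (intro power_strict_increasing less_exp) auto
  also have "(2::nat) ^ 2 ^ s \<le> b" unfolding b_def by (intro power_mono) auto
  finally have "s \<le> b ^ 1" by simp
  also have "(8::nat) ^ 0 \<le> b" unfolding b_def by (intro power_increasing_iff[THEN iffD2]) auto
  then have "b ^ 1 \<le> b ^ 4" by (intro power_increasing) auto
  finally have sb: "s \<le> b ^ 4" .
  have b8: "8 ^ 1 \<le> b" unfolding b_def by (intro power_increasing) auto
  have "(1 - 2 / real b) ^ 3 \<le> 1" using b8 by (intro power_le_one) auto
  then have "120 * (1 - 2 / b) ^ 3 * (M * s) \<le> 120 * (M * s)"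
    using m_pos mM by (intro mult_right_mono) auto
  with assms show ?thesis
    by (intro section_exists_aux[OF cover_system_axioms b_def sb]) linarith
qed

subsection \<open>Zero-sum cycles\<close>

text \<open>Following out-arcs for as many steps as there are vertices must repeat a vertex, which
  gives a closed walk and hence a cycle.\<close>

lemma (in wf_digraph) cycle_exists:
  assumes "finite (verts G)" "verts G \<noteq> {}"
    and out: "\<And>v. v \<in> verts G \<Longrightarrow> \<exists>a \<in> arcs G. tail G a = v"
  shows "\<exists>p. cycle p"
proof -
  have walk: "\<exists>p v. awalk u p v \<and> length p = n" if "u \<in> verts G" for u n
    using that
  proof (induction n arbitrary: u)
    case 0
    then show ?case by (intro exI[of _ "[]"]) (auto simp: awalk_Nil_iff)
  next
    case (Suc n)
    obtain a where a: "a \<in> arcs G" "tail G a = u" using out Suc.prems by blast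
    obtain p v where "awalk (head G a) p v" "length p = n" using Suc.IH[of "head G a"] a by auto
    then show ?case using a by (intro exI[of _ "a # p"]) (auto simp: awalk_Cons_iff)
  qed
  obtain u where "u \<in> verts G" using assms by blast
  from walk[OF this, of "card (verts G)"] obtain p v where
    p: "awalk u p v" "length p = card (verts G)" by blast
  have "length (awalk_verts u p) = Suc (card (verts G))" using p(2) by (simp add: length_awalk_verts)
  moreover have "set (awalk_verts u p) \<subseteq> verts G" using p(1) by (auto dest: awalkE')
  ultimately have "\<not> distinct (awalk_verts u p)"
    by (metis assms(1) card_mono distinct_card not_less_eq_eq order_refl)
  from awalk_not_distinct_decomp[OF p(1) this] obtain q where "closed_w q"
    by (auto simp: closed_w_def)
  then show ?thesis by (rule closed_w_imp_cycle)
qed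

text \<open>A candidate (v, x, c) is the vertex v with pair (x, c), and its successors are reached
  by good arcs. A section gives each vertex at most one pair and each chosen candidate a chosen
  successor. The last clause of the conclusion is what allows the extraction to be repeated.\<close>

lemma disjoint_zero_sum_cycles:
  fixes \<Gamma> :: "('g, 'm) monoid_scheme" and D :: "('a, 'b) pre_digraph" and m M :: real
  assumes "digraph D" "group \<Gamma>" and fin: "finite (carrier \<Gamma>)" and w: "w \<in> arcs D \<rightarrow> carrier \<Gamma>"
    and ne: "verts D \<noteq> {}" and A: "A \<subseteq> arcs D" and r: "r \<ge> 1" and m: "0 < m" "m \<le> M"
    and out: "\<And>v. v \<in> verts D \<Longrightarrow> m \<le> card {a \<in> A. tail D a = v}"
      "\<And>v. v \<in> verts D \<Longrightarrow> card {a \<in> A. tail D a = v} \<le> M"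
    and inn: "\<And>v. v \<in> verts D \<Longrightarrow> card {a \<in> A. head D a = v} \<le> M"
    and M: "120 * (M * real (order \<Gamma> * r)) \<le> m\<^sup>2"
  shows "\<exists>C :: nat \<Rightarrow> 'b list. (\<forall>c < r. zero_sum_cycle D \<Gamma> w (C c) \<and> set (C c) \<subseteq> A) \<and>
    (\<forall>c < r. \<forall>c' < r. c \<noteq> c' \<longrightarrow> set (C c) \<inter> set (C c') = {}) \<and>
    (\<forall>v. card {a \<in> (\<Union>c<r. set (C c)). tail D a = v} \<le> 1)"
proof -
  interpret digraph D by fact
  interpret \<Gamma>: group \<Gamma> by fact
  obtain v0 where v0: "v0 \<in> verts D" using ne by blast
  define P where "P = verts D \<times> carrier \<Gamma> \<times> {..<r}"
  \<comment> \<open>The copies \<open>r + c\<close> of the colours \<open>c < r\<close> at \<open>v0\<close> each force a chosen pair of colour \<open>c\<close>.\<close>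
  define Z where "Z = {v0} \<times> {\<one>\<^bsub>\<Gamma>\<^esub>} \<times> {r..<2 * r}"
  \<comment> \<open>On \<open>P\<close> the reduction mod r changes nothing; it sends the copies r +
    c in \<open>Z\<close> back to colour c.\<close>
  define N where "N = (\<lambda>(v, x, c). (\<lambda>a. (head D a, x \<otimes>\<^bsub>\<Gamma>\<^esub> w a, c mod r)) ` {a \<in> A. tail D a = v})"
  have finA: "finite A" using A finite_arcs finite_subset by blast
  have wA: "w a \<in> carrier \<Gamma>" if "a \<in> A" for a using that A w by blast
  have arc_eq: "a = b" if "a \<in> A" "b \<in> A" "tail D a = tail D b" "head D a = head D b" for a b
    using no_multi_arcs[of a b] that A by (auto simp: arc_to_ends_def)
  have inj_head: "inj_on (\<lambda>a. (head D a, x \<otimes>\<^bsub>\<Gamma>\<^esub> w a, c mod r)) {a \<in> A. tail D a = v}" for v x c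
    by (rule inj_onI) (auto intro: arc_eq)
  have cardN: "card (N (v, x, c)) = card {a \<in> A. tail D a = v}" for v x c
    unfolding N_def using inj_head by (simp add: card_image)
  have PZ: "fst p \<in> verts D" "fst (snd p) \<in> carrier \<Gamma>" if "p \<in> P \<union> Z" for p
    using that v0 by (auto simp: P_def Z_def)
  interpret cover_system P Z fst N "order \<Gamma> * r" m M
  proof
    show "finite P" using fin by (simp add: P_def)
    show "finite Z" by (simp add: Z_def)
    show "1 \<le> order \<Gamma> * r" using r fin \<Gamma>.order_gt_0_iff_finite by (simp add: Suc_le_eq)
    show "0 < m" "m \<le> M" by (fact m)+
    show "card {p \<in> P. fst p = v} = order \<Gamma> * r" if "v \<in> fst ` P" for v
    proof -
      obtain p where "p \<in> P" "v = fst p" using \<open>v \<in> fst ` P\<close> by blast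
      then have "v \<in> verts D" by (auto simp: P_def)
      then have "{p \<in> P. fst p = v} = {v} \<times> carrier \<Gamma> \<times> {..<r}" by (auto simp: P_def)
      then show ?thesis by (simp add: card_cartesian_product order_def)
    qed
    fix p assume p: "p \<in> P \<union> Z"
    obtain v x c where vxc: "p = (v, x, c)" by (cases p)
    show "N p \<subseteq> P" using PZ[OF p] r A wA by (auto simp: N_def P_def vxc)
    show "inj_on fst (N p)" by (rule inj_onI) (auto simp: N_def vxc dest: arc_eq)
    show "m \<le> card (N p)" "card (N p) \<le> M" using out PZ[OF p] by (auto simp: vxc cardN)
  next
    fix q assume "q \<in> P"
    then obtain v y c where q: "q = (v, y, c)" "v \<in> verts D" "y \<in> carrier \<Gamma>" "c < r"
      by (auto simp: P_def)
    \<comment> \<open>Going backwards, an arc a into v determines the predecessor: its group element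
      must be y w(a)^(-1). So in-degrees are bounded by those of \<open>A\<close>.\<close>
    have sub: "{p \<in> P. q \<in> N p} \<subseteq> (\<lambda>a. (tail D a, y \<otimes>\<^bsub>\<Gamma>\<^esub> inv\<^bsub>\<Gamma>\<^esub> (w a), c)) ` {a \<in> A. head D a = v}"
    proof
      fix p assume "p \<in> {p \<in> P. q \<in> N p}"
      then obtain u x a where "p = (u, x, c)" "x \<in> carrier \<Gamma>" "a \<in> A" "tail D a = u" "head D a = v"
        "y = x \<otimes>\<^bsub>\<Gamma>\<^esub> w a" by (auto simp: P_def N_def q)
      then show "p \<in> (\<lambda>a. (tail D a, y \<otimes>\<^bsub>\<Gamma>\<^esub> inv\<^bsub>\<Gamma>\<^esub> (w a), c)) ` {a \<in> A. head D a = v}"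
        using wA[of a] by (auto simp: \<Gamma>.m_assoc image_iff intro!: bexI[of _ a])
    qed
    have "inj_on fst ((\<lambda>a. (tail D a, y \<otimes>\<^bsub>\<Gamma>\<^esub> inv\<^bsub>\<Gamma>\<^esub> (w a), c)) ` {a \<in> A. head D a = v})"
      by (rule inj_onI) (auto dest: arc_eq)
    then show "inj_on fst {p \<in> P. q \<in> N p}" using sub by (rule inj_on_subset)
    have "card {p \<in> P. q \<in> N p} \<le> card {a \<in> A. head D a = v}"
      using sub finA by (intro surj_card_le) auto
    then show "card {p \<in> P. q \<in> N p} \<le> M" using inn[OF q(2)] by simp
    have "{z \<in> Z. q \<in> N z} \<subseteq> {(v0, \<one>\<^bsub>\<Gamma>\<^esub>, r + c)}"
    proof
      fix z assume "z \<in> {z \<in> Z. q \<in> N z}"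
      then obtain d where d: "z = (v0, \<one>\<^bsub>\<Gamma>\<^esub>, d)" "r \<le> d" "d < 2 * r" "c = d mod r"
        by (auto simp: Z_def N_def q)
      then have "d mod r = d - r" by (simp add: mod_if)
      with d show "z \<in> {(v0, \<one>\<^bsub>\<Gamma>\<^esub>, r + c)}" by simp
    qed
    from card_mono[OF _ this] show "card {z \<in> Z. q \<in> N z} \<le> 1" by simp
  qed
  obtain S where S: "S \<subseteq> P" "inj_on fst S" "\<And>p. p \<in> S \<union> Z \<Longrightarrow> N p \<inter> S \<noteq> {}"
    using section_exists M by blast
  have "\<exists>a \<in> A. tail D a = fst p \<and> (head D a, fst (snd p) \<otimes>\<^bsub>\<Gamma>\<^esub> w a, snd (snd p)) \<in> S" if "p \<in> S" for p
  proof -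
    obtain v x c where p: "p = (v, x, c)" by (cases p)
    then have "c < r" using that S(1) by (auto simp: P_def)
    then show ?thesis using S(3)[of p] that by (auto simp: p N_def)
  qed
  then obtain g where g: "\<And>p. p \<in> S \<Longrightarrow> g p \<in> A" "\<And>p. p \<in> S \<Longrightarrow> tail D (g p) = fst p"
    "\<And>v x c. (v, x, c) \<in> S \<Longrightarrow> (head D (g (v, x, c)), x \<otimes>\<^bsub>\<Gamma>\<^esub> w (g (v, x, c)), c) \<in> S"
    by (metis fst_conv snd_conv)
  \<comment> \<open>The tail of a chosen arc determines its candidate, hence also its colour. This
    gives disjointness of the cycles and the bound of one arc per tail.\<close>
  have g_unique: "p = q" if "p \<in> S" "q \<in> S" "tail D (g p) = tail D (g q)" for p q
    using that S(2) g(2) by (auto dest: inj_onD)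
  define S' where "S' c = {p \<in> S. snd (snd p) = c}" for c
  have "\<exists>p. zero_sum_cycle D \<Gamma> w p \<and> set p \<subseteq> g ` S' c" if c: "c < r" for c
  proof -
    \<comment> \<open>\<open>H\<close> consists of the chosen arcs of colour c. Each of its vertices
      has an out-arc, and \<open>Z\<close> ensures that it is not empty.\<close>
    define H where "H = \<lparr>verts = fst ` S' c, arcs = g ` S' c, tail = tail D, head = head D\<rparr>"
    have H_sel: "verts H = fst ` S' c" "arcs H = g ` S' c" "tail H = tail D" "head H = head D"
      by (simp_all add: H_def)
    have head_H: "head D (g p) \<in> fst ` S' c" if "p \<in> S' c" for p
      using that g(3) by (cases p) (force simp: S'_def)
    have tail_H: "tail D (g p) \<in> fst ` S' c" if "p \<in> S' c" for p
      using that g(2)[of p] by (simp add: S'_def)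
    interpret H: wf_digraph H
      by unfold_locales (use head_H tail_H in \<open>auto simp: H_sel\<close>)
    have "(v0, \<one>\<^bsub>\<Gamma>\<^esub>, r + c) \<in> Z" using c by (auto simp: Z_def)
    then have "N (v0, \<one>\<^bsub>\<Gamma>\<^esub>, r + c) \<inter> S \<noteq> {}" using S(3) by blast
    then have "S' c \<noteq> {}" using c by (auto simp: N_def S'_def)
    moreover have "finite (S' c)" using S(1) finP by (auto simp: S'_def intro: finite_subset)
    ultimately obtain p where p: "H.cycle p"
      using H.cycle_exists g(2) by (force simp: H_sel S'_def)
    \<comment> \<open>Telescoping: along a walk in \<open>H\<close> the group element of the current
      candidate is multiplied by the labels read so far.\<close>
    have walk: "(v, x \<otimes>\<^bsub>\<Gamma>\<^esub> label_prod \<Gamma> w q, c) \<in> S"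
      if "H.awalk u q v" "(u, x, c) \<in> S" for u q v x
      using that
    proof (induction q arbitrary: u x)
      case Nil
      then have "x \<in> carrier \<Gamma>" using S(1) by (auto simp: P_def)
      with Nil show ?case by (simp add: H.awalk_Nil_iff label_prod_def)
    next
      case (Cons a q)
      have x: "x \<in> carrier \<Gamma>" using Cons.prems S(1) by (auto simp: P_def)
      have a: "a \<in> g ` S' c" "tail D a = u" "H.awalk (head D a) q v"
        using Cons.prems by (auto simp: H.awalk_Cons_iff H_sel)
      then obtain p where p: "p \<in> S" "a = g p" by (auto simp: S'_def)
      then have "p = (u, x, c)"
        using g_unique[of p "(u, x, c)"] Cons.prems(2) a(2) g(2)[of "(u, x, c)"] by simp
      then have *: "a \<in> A" "(head D a, x \<otimes>\<^bsub>\<Gamma>\<^esub> w a, c) \<in> S"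
        using p g(1)[of p] g(3)[of u x c] Cons.prems(2) by auto
      have "set q \<subseteq> A" using a(3) g(1) by (auto simp: H.awalk_def H_sel S'_def)
      then have "label_prod \<Gamma> w q \<in> carrier \<Gamma>" using wA by (intro \<Gamma>.label_prod_closed) auto
      then have "x \<otimes>\<^bsub>\<Gamma>\<^esub> w a \<otimes>\<^bsub>\<Gamma>\<^esub> label_prod \<Gamma> w q = x \<otimes>\<^bsub>\<Gamma>\<^esub> label_prod \<Gamma> w (a # q)"
        using x wA[OF *(1)] by (simp add: label_prod_def \<Gamma>.m_assoc)
      with Cons.IH[OF a(3) *(2)] show ?case by simp
    qed
    obtain u where u: "H.awalk u p u" "distinct (tl (H.awalk_verts u p))" "p \<noteq> []"
      using p by (auto simp: H.cycle_def)
    have pg: "set p \<subseteq> g ` S' c" using u(1) by (auto simp: H.awalk_def H_sel)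
    then have pA: "set p \<subseteq> A" using g(1) by (auto simp: S'_def)
    have "u \<in> fst ` S' c" using u(1) by (auto simp: H.awalk_def H_sel)
    then obtain x where x: "(u, x, c) \<in> S" by (auto simp: S'_def)
    then have "(u, x \<otimes>\<^bsub>\<Gamma>\<^esub> label_prod \<Gamma> w p, c) \<in> S" using walk u(1) by blast
    \<comment> \<open>Back at u, the only chosen candidate is the initial one, so the label product
      fixes x and is the identity.\<close>
    from inj_onD[OF S(2) _ this x] have "x \<otimes>\<^bsub>\<Gamma>\<^esub> label_prod \<Gamma> w p = x" by simp
    moreover have "label_prod \<Gamma> w p \<in> carrier \<Gamma>" using pA wA by (intro \<Gamma>.label_prod_closed) auto
    moreover have "x \<in> carrier \<Gamma>" using x S(1) by (auto simp: P_def)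
    ultimately have "label_prod \<Gamma> w p = \<one>\<^bsub>\<Gamma>\<^esub>" by (simp add: \<Gamma>.l_cancel_one)
    moreover have "subgraph H D"
      unfolding subgraph_def compatible_def using g(1) A S(1) H.wf_digraph wf_digraph
      by (auto simp: H_sel S'_def P_def)
    then have "cycle p" using p by (rule subgraph_cycle)
    ultimately show ?thesis using pg by (auto simp: zero_sum_cycle_def)
  qed
  then obtain C where C: "\<And>c. c < r \<Longrightarrow> zero_sum_cycle D \<Gamma> w (C c)" "\<And>c. c < r \<Longrightarrow> set (C c) \<subseteq> g ` S' c"
    by metis
  show ?thesis
  proof (intro exI[of _ C] conjI allI impI)
    fix c assume "c < r"
    show "zero_sum_cycle D \<Gamma> w (C c)" using C(1) \<open>c < r\<close> by blast
    show "set (C c) \<subseteq> A" using C(2)[OF \<open>c < r\<close>] g(1) by (auto simp: S'_def)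
  next
    fix c c' assume c: "c < r" "c' < r" "c \<noteq> c'"
    show "set (C c) \<inter> set (C c') = {}"
    proof (rule ccontr)
      assume "set (C c) \<inter> set (C c') \<noteq> {}"
      then obtain a where "a \<in> set (C c)" "a \<in> set (C c')" by blast
      then obtain p q where pq: "p \<in> S' c" "a = g p" "q \<in> S' c'" "a = g q"
        using C(2)[OF c(1)] C(2)[OF c(2)] by blast
      then have "p = q" using g_unique[of p q] by (simp add: S'_def)
      with pq c(3) show False by (simp add: S'_def)
    qed
  next
    fix v
    let ?B = "{a \<in> (\<Union>c<r. set (C c)). tail D a = v}"
    have gS: "a \<in> g ` S" if "a \<in> ?B" for a
    proof -
      obtain c where "c < r" "a \<in> set (C c)" using \<open>a \<in> ?B\<close> by blast
      then show ?thesis using C(2)[of c] by (auto simp: S'_def)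
    qed
    have "a = b" if ab: "a \<in> ?B" "b \<in> ?B" for a b
    proof -
      obtain p q where "a = g p" "p \<in> S" "b = g q" "q \<in> S" using gS[OF ab(1)] gS[OF ab(2)] by blast
      moreover have "tail D a = tail D b" using ab by simp
      ultimately show ?thesis using g_unique[of p q] by simp
    qed
    moreover have "finite ?B" by simp
    ultimately show "card ?B \<le> 1" unfolding One_nat_def by (simp only: card_le_Suc0_iff_eq) blast
  qed
qed

section \<open>Repeated extraction and the final count\<close>

text \<open>Each of n rounds extracts r cycles and takes at most one out-arc from every vertex.
  Before the last round at most n - 1 out-arcs are gone, which explains the + 1 in the last
  hypothesis. The upper bounds M survive deletions.\<close>

lemma edge_disjoint_zero_sum_cycles:
  fixes \<Gamma> :: "('g, 'm) monoid_scheme" and D :: "('a, 'b) pre_digraph" and m M :: real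
  assumes D: "digraph D" and \<Gamma>: "group \<Gamma>" "finite (carrier \<Gamma>)" and w: "w \<in> arcs D \<rightarrow> carrier \<Gamma>"
    and ne: "verts D \<noteq> {}" and r: "r \<ge> 1" and m: "0 < m" "m \<le> M"
    and deg: "\<And>v. v \<in> verts D \<Longrightarrow> out_degree D v \<le> M" "\<And>v. v \<in> verts D \<Longrightarrow> in_degree D v \<le> M"
    and M: "120 * (M * real (order \<Gamma> * r)) \<le> m\<^sup>2"
    and n: "\<And>v. v \<in> verts D \<Longrightarrow> m + real n \<le> out_degree D v + 1"
  shows "\<exists>\<C>. finite \<C> \<and> (\<forall>p \<in> \<C>. zero_sum_cycle D \<Gamma> w p) \<and> edge_disjoint_family \<C> \<and> card \<C> = n * r"
proof -
  interpret digraph D by fact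
  have "\<exists>\<C>. finite \<C> \<and> (\<forall>p \<in> \<C>. zero_sum_cycle D \<Gamma> w p) \<and> edge_disjoint_family \<C> \<and> card \<C> = i * r \<and>
      (\<forall>v \<in> verts D. out_degree D v \<le> card {a \<in> arcs D - \<Union>(set ` \<C>). tail D a = v} + i)"
    if "i \<le> n" for i
    using that
  proof (induction i)
    case 0
    then show ?case
      by (intro exI[of _ "{}"]) (auto simp: edge_disjoint_family_def out_degree_def out_arcs_def)
  next
    case (Suc i)
    then obtain \<C> where \<C>: "finite \<C>" "\<And>p. p \<in> \<C> \<Longrightarrow> zero_sum_cycle D \<Gamma> w p"
      "edge_disjoint_family \<C>" "card \<C> = i * r"
      and rest: "\<And>v. v \<in> verts D \<Longrightarrow> out_degree D v \<le> card {a \<in> arcs D - \<Union>(set ` \<C>). tail D a = v} + i"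
      by auto
    define A where "A = arcs D - \<Union>(set ` \<C>)"
    have A: "A \<subseteq> arcs D" by (auto simp: A_def)
    have low: "m \<le> card {a \<in> A. tail D a = v}" if "v \<in> verts D" for v
      using rest[OF that] n[OF that] Suc.prems by (simp add: A_def)
    have up: "card {a \<in> A. tail D a = v} \<le> M" if "v \<in> verts D" for v
    proof -
      have "card {a \<in> A. tail D a = v} \<le> out_degree D v"
        unfolding out_degree_def out_arcs_def using A by (intro card_mono) auto
      then show ?thesis using deg(1)[OF that] by linarith
    qed
    have inn: "card {a \<in> A. head D a = v} \<le> M" if "v \<in> verts D" for v
    proof -
      have "card {a \<in> A. head D a = v} \<le> in_degree D v"
        unfolding in_degree_def in_arcs_def using A by (intro card_mono) auto
      then show ?thesis using deg(2)[OF that] by linarith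
    qed
    have "\<exists>C. (\<forall>c < r. zero_sum_cycle D \<Gamma> w (C c) \<and> set (C c) \<subseteq> A) \<and>
        (\<forall>c < r. \<forall>c' < r. c \<noteq> c' \<longrightarrow> set (C c) \<inter> set (C c') = {}) \<and>
        (\<forall>v. card {a \<in> (\<Union>c<r. set (C c)). tail D a = v} \<le> 1)"
      by (rule disjoint_zero_sum_cycles[OF D \<Gamma> w ne A r m low up inn M])
    then obtain C where raw: "\<forall>c < r. zero_sum_cycle D \<Gamma> w (C c) \<and> set (C c) \<subseteq> A"
        "\<forall>c < r. \<forall>c' < r. c \<noteq> c' \<longrightarrow> set (C c) \<inter> set (C c') = {}"
        "\<forall>v. card {a \<in> (\<Union>c<r. set (C c)). tail D a = v} \<le> 1"
      by (elim exE conjE)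
    have C: "\<And>c. c < r \<Longrightarrow> zero_sum_cycle D \<Gamma> w (C c)" "\<And>c. c < r \<Longrightarrow> set (C c) \<subseteq> A"
        "\<And>c c'. \<lbrakk>c < r; c' < r; c \<noteq> c'\<rbrakk> \<Longrightarrow> set (C c) \<inter> set (C c') = {}"
      and once: "\<And>v. card {a \<in> (\<Union>c<r. set (C c)). tail D a = v} \<le> 1"
      using raw by simp_all
    \<comment> \<open>Disjoint arc sets show two cycles to be different only because cycles have
      arcs; this makes the count exactly r per round.\<close>
    have nonempty: "set p \<noteq> {}" if "zero_sum_cycle D \<Gamma> w p" for p
      using that by (auto simp: zero_sum_cycle_def cycle_def)
    have inj: "inj_on C {..<r}"
    proof (rule inj_onI)
      fix c c' assume "c \<in> {..<r}" "c' \<in> {..<r}" "C c = C c'"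
      then show "c = c'" using C(3)[of c c'] nonempty[OF C(1)[of c]] by auto
    qed
    have new: "set p \<inter> set (C c) = {}" if "p \<in> \<C>" "c < r" for p c
      using C(2)[OF that(2)] that(1) by (auto simp: A_def)
    have disj: "\<C> \<inter> C ` {..<r} = {}"
    proof (rule ccontr)
      assume "\<C> \<inter> C ` {..<r} \<noteq> {}"
      then obtain c where "c < r" "C c \<in> \<C>" by blast
      then show False using new[of "C c" c] nonempty[OF C(1)[of c]] by simp
    qed
    show ?case
    proof (intro exI[of _ "\<C> \<union> C ` {..<r}"] conjI ballI)
      show "finite (\<C> \<union> C ` {..<r})" using \<C> by simp
      show "zero_sum_cycle D \<Gamma> w p" if "p \<in> \<C> \<union> C ` {..<r}" for p using that \<C> C by auto
      show "edge_disjoint_family (\<C> \<union> C ` {..<r})"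
        unfolding edge_disjoint_family_def
      proof (rule pairwiseI)
        fix p q assume "p \<in> \<C> \<union> C ` {..<r}" "q \<in> \<C> \<union> C ` {..<r}" "p \<noteq> q"
        then consider "p \<in> \<C>" "q \<in> \<C>" | c where "p \<in> \<C>" "c < r" "q = C c"
          | c where "q \<in> \<C>" "c < r" "p = C c" | c c' where "c < r" "c' < r" "p = C c" "q = C c'"
          by blast
        then show "set p \<inter> set q = {}"
        proof cases
          case 1
          then show ?thesis using \<C>(3) \<open>p \<noteq> q\<close> by (simp add: edge_disjoint_family_def pairwise_def)
        next
          case 2
          then show ?thesis using new by simp
        next
          case 3
          then show ?thesis using new by (simp add: Int_commute)
        next
          case 4
          with \<open>p \<noteq> q\<close> show ?thesis using C(3)[of c c'] by auto
        qed
      qed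
      show "card (\<C> \<union> C ` {..<r}) = Suc i * r"
        using \<C> disj inj by (simp add: card_Un_disjoint card_image)
      fix v assume v: "v \<in> verts D"
      let ?B = "arcs D - \<Union>(set ` (\<C> \<union> C ` {..<r}))"
      have "{a \<in> A. tail D a = v} \<subseteq> {a \<in> ?B. tail D a = v} \<union> {a \<in> (\<Union>c<r. set (C c)). tail D a = v}"
        by (auto simp: A_def)
      then have "card {a \<in> A. tail D a = v} \<le>
          card ({a \<in> ?B. tail D a = v} \<union> {a \<in> (\<Union>c<r. set (C c)). tail D a = v})"
        by (intro card_mono) auto
      also have "\<dots> \<le> card {a \<in> ?B. tail D a = v} + card {a \<in> (\<Union>c<r. set (C c)). tail D a = v}"
        by (rule card_Un_le)
      finally show "out_degree D v \<le> card {a \<in> ?B. tail D a = v} + Suc i"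
        using rest[OF v] once[of v] by (simp add: A_def)
    qed
  qed
  from this[of n] show ?thesis by blast
qed

theorem theorem5p6:
  fixes \<Gamma> :: "('g, 'm) monoid_scheme"
    and D :: "('a, 'b) pre_digraph"
    and w :: "'b \<Rightarrow> 'g"
    and k \<delta> \<Delta> :: nat
  assumes "group \<Gamma>"
    and "finite (carrier \<Gamma>)"
    and "order \<Gamma> = k"
    and "k \<ge> 2"
    and "eulerian_digraph D"
    and "w \<in> arcs D \<rightarrow> carrier \<Gamma>"
    and "\<delta> = min_degree D"
    and "\<Delta> = max_degree D"
    and "\<Delta> > 0"
    and "real \<delta> ^ 3 / real \<Delta> ^ 2 \<ge> 32 * exp 1 ^ 3 * real k"
  shows "\<exists>\<C> :: 'b list set. finite \<C> \<and>
           (\<forall>p \<in> \<C>. zero_sum_cycle D \<Gamma> w p) \<and>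
           edge_disjoint_family \<C> \<and>
           real (card \<C>) \<ge> real \<delta> ^ 4 / (128 * exp 1 ^ 3 * real k * real \<Delta> ^ 2)"
proof -
  have D: "digraph D" "verts D \<noteq> {}" and eul: "\<And>v. v \<in> verts D \<Longrightarrow> out_degree D v = in_degree D v"
    using assms(5) by (auto simp: eulerian_digraph_def)
  interpret digraph D by fact
  have \<delta>: "\<delta> \<le> out_degree D v" if "v \<in> verts D" for v
    using that by (simp add: assms(7) min_degree_def common_degree_def)
  have \<Delta>: "out_degree D v \<le> \<Delta>" if "v \<in> verts D" for v
    using that by (simp add: assms(8) max_degree_def common_degree_def)
  have \<delta>\<Delta>: "\<delta> \<le> \<Delta>" using \<delta> \<Delta> D(2) by (meson equals0I order_trans)
  define E :: real where "E = exp 1 ^ 3"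
  have "(5/2) ^ 3 \<le> E"
    unfolding E_def using exp_lower_Taylor_quadratic[of 1] by (intro power_mono) auto
  then have E: "15 \<le> E" by (simp add: power_divide)
  \<comment> \<open>X \<ge> 1 is the degree hypothesis of the theorem. The number of colours is r,
    the integer part of X, and rounding costs at most a factor 2.\<close>
  define X where "X = real \<delta> ^ 3 / (32 * E * k * real \<Delta> ^ 2)"
  have pos: "32 * E * k * real \<Delta> ^ 2 > 0" using E assms by simp
  have X1: "1 \<le> X" using assms(9,10) pos E by (simp add: X_def E_def[symmetric] field_simps)
  define r where "r = nat \<lfloor>X\<rfloor>"
  have "1 \<le> \<lfloor>X\<rfloor>" using X1 by simp
  then have "real r = \<lfloor>X\<rfloor>" "1 \<le> r" unfolding r_def by linarith+
  moreover from \<open>1 \<le> \<lfloor>X\<rfloor>\<close> have "X / 2 \<le> \<lfloor>X\<rfloor>" by linarith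
  ultimately have r: "1 \<le> r" "real r \<le> X" "X / 2 \<le> r" by simp_all
  have \<delta>0: "\<delta> > 0" using X1 by (intro Nat.gr0I) (simp add: X_def)
  have "32 * E * k * real \<Delta> ^ 2 * r \<le> 32 * E * k * real \<Delta> ^ 2 * X" using r pos by (intro mult_left_mono) auto
  also have "\<dots> = real \<delta> ^ 3"
    unfolding X_def using pos by (metis less_irrefl nonzero_mult_div_cancel_left times_divide_eq_right)
  also have "\<dots> = real \<delta> ^ 2 * \<delta>" by (simp add: power3_eq_cube power2_eq_square)
  also have "\<dots> \<le> real \<delta> ^ 2 * \<Delta>" using \<delta>\<Delta> by (intro mult_left_mono) auto
  finally have "(32 * E * k * \<Delta> * r) * \<Delta> \<le> real \<delta> ^ 2 * \<Delta>" by (simp add: power2_eq_square mult_ac)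
  then have "32 * E * k * \<Delta> * r \<le> real \<delta> ^ 2"
    using assms(9) by (simp add: mult_ac)
  \<comment> \<open>The constant works out as 32 * 15 = 480 = 4 * 120, the 4 coming from the square
    of m = \<delta>/2.\<close>
  moreover have "32 * 15 * (real k * \<Delta> * r) \<le> 32 * E * (real k * \<Delta> * r)"
    using E by (intro mult_right_mono) auto
  ultimately have "480 * (real k * \<Delta> * r) \<le> real \<delta> ^ 2" by (simp only: mult.assoc)
  then have M: "120 * (real \<Delta> * real (order \<Gamma> * r)) \<le> (real \<delta> / 2)\<^sup>2"
    by (simp add: assms(3) power_divide mult_ac)
  \<comment> \<open>There are \<delta>/2 rounds, rounded up, and each starts with all out-degrees at
    least \<delta>/2.\<close>
  have n: "real \<delta> / 2 + real ((\<delta> + 1) div 2) \<le> out_degree D v + 1" if "v \<in> verts D" for v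
  proof -
    have "2 * ((\<delta> + 1) div 2) \<le> \<delta> + 1" by simp
    then show ?thesis using \<delta>[OF that] by linarith
  qed
  obtain \<C> where \<C>: "finite \<C>" "\<forall>p \<in> \<C>. zero_sum_cycle D \<Gamma> w p" "edge_disjoint_family \<C>"
    "card \<C> = (\<delta> + 1) div 2 * r"
    using edge_disjoint_zero_sum_cycles[OF D(1) assms(1,2,6) D(2) r(1) _ _ _ _ M n] \<delta>0 \<delta>\<Delta> \<Delta>
    by (auto simp flip: eul)
  \<comment> \<open>The factor 128 is 32 * 2 * 2: one 2 from the number of rounds, one from rounding
    X down.\<close>
  have "real \<delta> ^ 4 / (128 * exp 1 ^ 3 * real k * real \<Delta> ^ 2) = real \<delta> / 2 * (X / 2)"
    by (simp add: X_def E_def eval_nat_numeral)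
  also have "\<dots> \<le> real ((\<delta> + 1) div 2) * r" using r by (intro mult_mono) auto
  also have "\<dots> = card \<C>" by (simp add: \<C>(4))
  finally show ?thesis using \<C>(1-3) by blast
qed

end
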